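(* Let $1\le m\le n$, let $A\in\mathbb{R}^{n\times n}$ be invertible, let $W,V\in\mathbb{R}^{n\times m}$ be full-rank matrices with $W^{T}AV$ invertible, and let $b,x_0\in\mathbb{R}^n$. Let $Y\in\mathbb{R}^{n\times(n-m)}$ be a matrix whose columns are $n-m$ linearly independent vectors from $\mathrm{Null}(W^{T}A)$, and let $P_2=Y\left(Y^{T}Y\right)^{-1}Y^{T}$. Then: 1. $P_2$ is an orthogonal projector on $\mathrm{Null}(W^{T}A)$. 2. For every symmetric positive semidefinite $G\in\mathbb{R}^{n\times n}$, if $x\sim\mathcal{N}(x_0,\Sigma_0)$ with $\Sigma_0=VV^{T}+P_2GP_2^{T}$, then the conditional distribution of $x$ given $W^{T}Ax=W^{T}b$ is $\mathcal{N}(\widetilde{x},P_2GP_2^{T})$, where $\widetilde{x}=x_0+V\left(W^{T}AV\right)^{-1}W^{T}(b-Ax_0)$.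
   Context: For a symmetric positive semidefinite $\Sigma$ (possibly singular), $\mathcal{N}(\mu,\Sigma)$ denotes the (possibly degenerate) Gaussian distribution with mean $\mu$ and covariance $\Sigma$. An orthogonal projector on a subspace $S$ is a matrix $P$ with $P^2=P=P^T$ and $\mathrm{Range}(P)=S$. Conditioning is the usual conditioning of jointly Gaussian vectors. *)

theory Defs
  imports
    "HOL-Probability.Probability"
    "Jordan_Normal_Form.Gauss_Jordan_Elimination"
    "Jordan_Normal_Form.Matrix_Kernel"
    "Jordan_Normal_Form.DL_Rank"
begin

unbundle no vec_syntax
hide_type (open) Finite_Cartesian_Product.vec
hide_const (open) Finite_Cartesian_Product.vec Finite_Cartesian_Product.mat

(* Dimensions are natural numbers, so that n x (n - m) matrices with n = m (no columns) are covered. *)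

(* "the" is harmless on invertible matrices only: mat_inverse returns None exactly on the others. *)
abbreviation mat_inv :: "real mat \<Rightarrow> real mat" where
  "mat_inv A \<equiv> the (mat_inverse A)"

definition lin_indpt_cols :: "real mat \<Rightarrow> bool" where
  "lin_indpt_cols A \<longleftrightarrow> distinct (cols A) \<and>
     \<not> module.lin_dep class_ring (module_vec TYPE(real) (dim_row A)) (set (cols A))"

definition orthogonal_projector_on :: "nat \<Rightarrow> real mat \<Rightarrow> real vec set \<Rightarrow> bool" where
  "orthogonal_projector_on n P S \<longleftrightarrow>
     P \<in> carrier_mat n n \<and> P * P = P \<and> transpose_mat P = P \<and>
     (\<lambda>v. P *\<^sub>v v) ` carrier_vec n = S"

definition sym_psd :: "nat \<Rightarrow> real mat \<Rightarrow> bool" where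
  "sym_psd n S \<longleftrightarrow> S \<in> carrier_mat n n \<and> transpose_mat S = S \<and>
     (\<forall>a\<in>carrier_vec n. 0 \<le> scalar_prod a (S *\<^sub>v a))"

(* The Borel sigma-algebra of R^n, transported from the product sigma-algebra. *)
definition borel_vec :: "nat \<Rightarrow> real vec measure" where
  "borel_vec n =
     vimage_algebra (carrier_vec n) (\<lambda>v. \<lambda>i\<in>{..<n}. v $ i) (Pi\<^sub>M {..<n} (\<lambda>_. borel))"

definition vec_tendsto :: "nat \<Rightarrow> (nat \<Rightarrow> real vec) \<Rightarrow> real vec \<Rightarrow> bool" where
  "vec_tendsto n u l \<longleftrightarrow> (\<forall>i<n. (\<lambda>k. u k $ i) \<longlonglongrightarrow> l $ i)"

definition continuous_vec :: "nat \<Rightarrow> (real vec \<Rightarrow> real) \<Rightarrow> bool" where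
  "continuous_vec n f \<longleftrightarrow>
     (\<forall>u l. (\<forall>k. u k \<in> carrier_vec n) \<longrightarrow> l \<in> carrier_vec n \<longrightarrow> vec_tendsto n u l \<longrightarrow>
        (\<lambda>k. f (u k)) \<longlonglongrightarrow> f l)"

definition weakly_tendsto ::
    "nat \<Rightarrow> (nat \<Rightarrow> real vec measure) \<Rightarrow> real vec measure \<Rightarrow> bool" where
  "weakly_tendsto n N L \<longleftrightarrow>
     (\<forall>f. continuous_vec n f \<longrightarrow> (\<exists>B. \<forall>x\<in>carrier_vec n. \<bar>f x\<bar> \<le> B) \<longrightarrow>
        (\<lambda>k. \<integral>x. f x \<partial>(N k)) \<longlonglongrightarrow> (\<integral>x. f x \<partial>L))"

(* The second parameter is the variance; variance 0 gives the point mass at the mean. *)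
definition normal_real :: "real \<Rightarrow> real \<Rightarrow> real measure" where
  "normal_real \<mu> v =
     (if 0 < v then density lborel (\<lambda>x. ennreal (normal_density \<mu> (sqrt v) x)) else return borel \<mu>)"

(* N is the possibly degenerate Gaussian with mean \<mu> and covariance S: every linear functional a.x
   is univariate normal with mean a.\<mu> and variance a.(S a). *)
definition is_gaussian :: "nat \<Rightarrow> real vec \<Rightarrow> real mat \<Rightarrow> real vec measure \<Rightarrow> bool" where
  "is_gaussian n \<mu> S N \<longleftrightarrow>
     \<mu> \<in> carrier_vec n \<and> sym_psd n S \<and> sets N = sets (borel_vec n) \<and>
     (\<forall>a\<in>carrier_vec n.
        distr N borel (\<lambda>x. scalar_prod a x) = normal_real (scalar_prod a \<mu>) (scalar_prod a (S *\<^sub>v a)))"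

(* \<kappa> is a regular conditional distribution of the n-dimensional X given the m-dimensional Z. *)
definition regular_cond_distr ::
    "'w measure \<Rightarrow> nat \<Rightarrow> ('w \<Rightarrow> real vec) \<Rightarrow> nat \<Rightarrow> ('w \<Rightarrow> real vec) \<Rightarrow>
     (real vec \<Rightarrow> real vec measure) \<Rightarrow> bool" where
  "regular_cond_distr M n X m Z \<kappa> \<longleftrightarrow>
     X \<in> measurable M (borel_vec n) \<and> Z \<in> measurable M (borel_vec m) \<and>
     \<kappa> \<in> measurable (borel_vec m) (prob_algebra (borel_vec n)) \<and>
     (\<forall>B\<in>sets (borel_vec n). \<forall>C\<in>sets (borel_vec m).
        emeasure M {\<omega> \<in> space M. X \<omega> \<in> B \<and> Z \<omega> \<in> C} =
        (\<integral>\<^sup>+ z. emeasure (\<kappa> z) B * indicator C z \<partial>(distr M (borel_vec m) Z)))"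

(* N is the conditional distribution of X given Z = z, where Z = z may be a null event. A regular
   conditional distribution is unique only almost everywhere, so its value at a point is fixed by
   taking the version that is weakly continuous at z. As z lies in the support of the law of Z,
   two such versions agree at z, so N is uniquely determined. *)
definition cond_distr_at ::
    "'w measure \<Rightarrow> nat \<Rightarrow> ('w \<Rightarrow> real vec) \<Rightarrow> nat \<Rightarrow> ('w \<Rightarrow> real vec) \<Rightarrow>
     real vec \<Rightarrow> real vec measure \<Rightarrow> bool" where
  "cond_distr_at M n X m Z z N \<longleftrightarrow>
     z \<in> carrier_vec m \<and>
     (\<forall>e>0. 0 < emeasure M {\<omega> \<in> space M. \<forall>i<m. \<bar>Z \<omega> $ i - z $ i\<bar> < e}) \<and>
     (\<exists>\<kappa>. regular_cond_distr M n X m Z \<kappa> \<and> \<kappa> z = N \<and>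
        (\<forall>u. (\<forall>k. u k \<in> carrier_vec m) \<longrightarrow> vec_tendsto m u z \<longrightarrow>
           weakly_tendsto n (\<lambda>k. \<kappa> (u k)) (\<kappa> z)))"

end

theory Submission
  imports Defs
begin

text \<open>Write B for the transpose of W times A, and put L = B V, Q = V times the inverse of L, and R = 1 - Q B.
  Then B Q = 1, the matrix Q B fixes V and kills the range of the projector, and R does the opposite.
  So the covariance of x is the sum of the covariances of Q B x and R x, and comparing characteristic
  functions shows that x has the same law as Q B v + R w with independent copies v and w of x.
  As B (Q B v + R w) = B v, the law of Q z + R x is a regular conditional distribution of x given B x = z.
  It depends on z only through a translation and is therefore weakly continuous. The vector B x has
  the nondegenerate covariance L times its transpose, so every point lies in the support of its law.

  Equality of laws is deduced from equality of characteristic functions, for which the uniqueness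
  theorem is lifted from one dimension to n.\<close>

subsection \<open>Linear algebra\<close>

text \<open>Since the covariance may be singular, x need not have a density, and
  \<open>B x = z\<close> is a null event; so one can condition neither by dividing densities nor by
  restricting to an event. This is what the independent copies are for: under the product measure,
  fixing v and integrating over w directly gives the kernel at \<open>B v\<close>. Only the law of x
  enters, and independence of \<open>Q B x\<close> and \<open>R x\<close> need not be established.
  The covariance has no cross terms because \<open>R V = 0\<close> and
  \<open>Q B P\<^sub>2 = 0\<close>: each of its two summands is seen by only one of the two maps.
  The mean \<open>Q z + R x\<^sub>0\<close> equals \<open>x\<^sub>0 + Q (z - B x\<^sub>0)\<close>,
  which is the stated one for z = W^T b, and the covariance of \<open>R x\<close> is
  \<open>P\<^sub>2 G P\<^sub>2^T\<close>. In the claim about the projector, \<open>Q\<close> serves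
  a second time: as a right inverse of \<open>B\<close> it shows that the kernel of \<open>B\<close>
  is no larger than the range of \<open>Y\<close>.\<close>

lemma mat_inv_left_right:
  assumes A: "A \<in> carrier_mat n n" and "det A \<noteq> 0"
  shows "mat_inv A \<in> carrier_mat n n" "mat_inv A * A = 1\<^sub>m n" "A * mat_inv A = 1\<^sub>m n"
proof -
  \<comment> \<open>A nonzero determinant makes \<open>A\<close> a unit of the matrix ring, which
    excludes the value \<open>None\<close>.\<close>
  obtain B where "mat_inverse A = Some B"
    using mat_inverse(1)[OF A, of "()"] det_non_zero_imp_unit[OF assms, of "()"] by fastforce
  with mat_inverse(2)[OF A] show "mat_inv A \<in> carrier_mat n n" "mat_inv A * A = 1\<^sub>m n" "A * mat_inv A = 1\<^sub>m n"
    by auto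
qed

lemma det_nonzeroI_ker:
  fixes A :: "real mat"
  assumes "A \<in> carrier_mat n n" "\<And>v. v \<in> carrier_vec n \<Longrightarrow> A *\<^sub>v v = 0\<^sub>v n \<Longrightarrow> v = 0\<^sub>v n"
  shows "det A \<noteq> 0"
  using assms det_0_iff_vec_prod_zero[OF assms(1)] by blast

lemma det_nonzeroI_invertible_mat:
  fixes A :: "real mat"
  assumes A: "A \<in> carrier_mat n n" and "invertible_mat A"
  shows "det A \<noteq> 0"
proof -
  obtain B where B: "A * B = 1\<^sub>m n" "B * A = 1\<^sub>m (dim_row B)"
    using assms by (auto simp: invertible_mat_def inverts_mat_def)
  \<comment> \<open>\<open>invertible_mat\<close> leaves the shape of \<open>B\<close> open;
    comparing column counts in the two identities recovers it.\<close>
  have "dim_col B = n" using arg_cong[OF B(1), of dim_col] by simp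
  moreover have "dim_row B = n" using arg_cong[OF B(2), of dim_col] A by simp
  ultimately have "B \<in> carrier_mat n n" by auto
  from det_mult[OF A this] B(1) show ?thesis by auto
qed

text \<open>Linear dependence is defined for a set of vectors. Because the columns are distinct, a
  coefficient vector indexed by columns is also a choice of coefficients on that set.\<close>

lemma lin_indpt_cols_ker:
  assumes Y: "Y \<in> carrier_mat n k" and "lin_indpt_cols Y"
    and v: "v \<in> carrier_vec k" "Y *\<^sub>v v = 0\<^sub>v n"
  shows "v = 0\<^sub>v k"
proof (rule ccontr)
  assume "v \<noteq> 0\<^sub>v k"
  then have "module.lin_dep class_ring (module_vec TYPE(real) n) (set (cols Y))"
    using vec_space.lin_depI[OF Y v(1) _ v(2)] assms(2) by (simp add: lin_indpt_cols_def)
  then show False using assms(2) Y by (auto simp: lin_indpt_cols_def)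
qed

lemma scalar_prod_self_zeroD:
  fixes v :: "real vec"
  assumes "v \<in> carrier_vec n" "scalar_prod v v = 0"
  shows "v = 0\<^sub>v n"
proof -
  have "(\<Sum>i<n. v $ i * v $ i) = 0"
    using assms by (simp add: scalar_prod_def lessThan_atLeast0)
  then have "\<forall>i\<in>{..<n}. v $ i * v $ i = 0"
    by (subst (asm) sum_nonneg_eq_0_iff) auto
  then show ?thesis using assms(1) by auto
qed

text \<open>The squared length of \<open>Y v\<close> is the scalar product of \<open>Y^T Y v\<close>
  with \<open>v\<close>, so the Gram matrix has no larger kernel than \<open>Y\<close>.\<close>

lemma det_gram_nonzero:
  fixes Y :: "real mat"
  assumes Y: "Y \<in> carrier_mat n k"
    and ker: "\<And>v. v \<in> carrier_vec k \<Longrightarrow> Y *\<^sub>v v = 0\<^sub>v n \<Longrightarrow> v = 0\<^sub>v k"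
  shows "det (transpose_mat Y * Y) \<noteq> 0"
proof (rule det_nonzeroI_ker)
  show "transpose_mat Y * Y \<in> carrier_mat k k" using Y by simp
  fix v :: "real vec" assume v: "v \<in> carrier_vec k" and 0: "transpose_mat Y * Y *\<^sub>v v = 0\<^sub>v k"
  have "scalar_prod (Y *\<^sub>v v) (Y *\<^sub>v v) = scalar_prod (transpose_mat Y *\<^sub>v (Y *\<^sub>v v)) v"
    using Y v transpose_vec_mult_scalar[of Y n k v "Y *\<^sub>v v"] by simp
  also have "transpose_mat Y *\<^sub>v (Y *\<^sub>v v) = 0\<^sub>v k"
    using 0 Y v assoc_mult_mat_vec[of "transpose_mat Y" k n Y k v] by simp
  finally have "Y *\<^sub>v v = 0\<^sub>v n"
    using Y v by (intro scalar_prod_self_zeroD) auto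
  then show "v = 0\<^sub>v k" using ker v by blast
qed

text \<open>The range lies in the kernel because \<open>B * Y\<close> vanishes. For the converse,
  the residual \<open>u - P u\<close> of a kernel vector is killed by \<open>B\<close> and by the
  transpose of \<open>Y\<close> at once, and only the zero vector is.\<close>

lemma orthogonal_projector_on_mat_kernel:
  fixes B Q Y :: "real mat"
  assumes mn: "m \<le> n" and B: "B \<in> carrier_mat m n" and Q: "Q \<in> carrier_mat n m" and BQ: "B * Q = 1\<^sub>m m"
    and Y: "Y \<in> carrier_mat n (n - m)" and BY: "B * Y = 0\<^sub>m m (n - m)"
    and det: "det (transpose_mat Y * Y) \<noteq> 0"
  shows "orthogonal_projector_on n (Y * mat_inv (transpose_mat Y * Y) * transpose_mat Y) (mat_kernel B)"
proof -
  define k where "k = n - m"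
  define H where "H = mat_inv (transpose_mat Y * Y)"
  define P where "P = Y * H * transpose_mat Y"
  note Y = Y[folded k_def] and BY = BY[folded k_def]
  have G: "transpose_mat Y * Y \<in> carrier_mat k k" using Y by simp
  note H = mat_inv_left_right[OF G det, folded H_def]
  have YT: "transpose_mat Y \<in> carrier_mat k n" using Y by simp
  have P: "P \<in> carrier_mat n n" using Y H unfolding P_def by simp
  \<comment> \<open>The Gram matrix is symmetric, so transposing its left inverse gives a right
    inverse; the two must agree.\<close>
  have HT: "transpose_mat H = H"
  proof -
    have "transpose_mat (H * (transpose_mat Y * Y)) = 1\<^sub>m k" using H by simp
    then have *: "transpose_mat Y * Y * transpose_mat H = 1\<^sub>m k"
      using H Y by (subst (asm) transpose_mult[OF H(1) G]) (simp add: transpose_mult[OF YT Y])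
    have "H * (transpose_mat Y * Y * transpose_mat H) = transpose_mat H"
      using H G by (subst assoc_mult_mat[symmetric, OF H(1) G]) auto
    then show ?thesis using * H by simp
  qed
  \<comment> \<open>This identity yields idempotence, and later it makes residuals orthogonal to the
    columns of \<open>Y\<close>.\<close>
  have YTP: "transpose_mat Y * P = transpose_mat Y"
  proof -
    have "transpose_mat Y * P = transpose_mat Y * (Y * H) * transpose_mat Y"
      unfolding P_def using Y H by (intro assoc_mult_mat[symmetric]) auto
    also have "transpose_mat Y * (Y * H) = 1\<^sub>m k"
      using assoc_mult_mat[OF YT Y H(1)] H by simp
    finally show ?thesis using Y by simp
  qed
  have PP: "P * P = P"
  proof -
    have "P * P = Y * H * (transpose_mat Y * P)"
      unfolding P_def using Y H P unfolding P_def by (intro assoc_mult_mat) auto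
    then show ?thesis unfolding YTP by (simp add: P_def)
  qed
  have PT: "transpose_mat P = P"
  proof -
    have "transpose_mat P = Y * transpose_mat (Y * H)"
      unfolding P_def using Y H by (subst transpose_mult[of _ n k _ n]) auto
    also have "transpose_mat (Y * H) = H * transpose_mat Y"
      using Y H HT by (subst transpose_mult[of _ n k _ k]) auto
    finally show ?thesis
      unfolding P_def using Y H by (simp add: assoc_mult_mat[OF Y H(1) YT])
  qed
  have Pv: "P *\<^sub>v v = Y *\<^sub>v (H *\<^sub>v (transpose_mat Y *\<^sub>v v))" if "v \<in> carrier_vec n" for v
    unfolding P_def using that Y H
    by (simp add: assoc_mult_mat_vec[of _ n k _ n] assoc_mult_mat_vec[of _ n k _ k])
  have BYv: "B *\<^sub>v (Y *\<^sub>v v) = 0\<^sub>v m" if "v \<in> carrier_vec k" for v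
    using that B Y BY by (auto simp flip: assoc_mult_mat_vec[of _ m n _ k] simp: vec_eq_iff scalar_prod_def)
  have YTY: "transpose_mat Y *\<^sub>v (Y *\<^sub>v (H *\<^sub>v v)) = v" if "v \<in> carrier_vec k" for v
    using that H Y by (simp flip: assoc_mult_mat_vec[of _ k n _ k] assoc_mult_mat_vec[of _ k k _ k])

  \<comment> \<open>Stacking B on top of the transpose of Y gives a square matrix that is surjective, hence
    injective. This replaces the dimension count for the kernel of B.\<close>
  define K where "K = B @\<^sub>r transpose_mat Y"
  have K: "K \<in> carrier_mat n n"
    using carrier_append_rows[OF B YT] mn by (simp add: K_def k_def)
  have Kv: "K *\<^sub>v v = (B *\<^sub>v v) @\<^sub>v (transpose_mat Y *\<^sub>v v)" if "v \<in> carrier_vec n" for v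
    unfolding K_def using mat_mult_append[OF B YT that] .
  have K_surj: "\<exists>v\<in>carrier_vec n. K *\<^sub>v v = x" if x: "x \<in> carrier_vec n" for x
  proof -
    define x1 where "x1 = vec_first x m"
    define x2 where "x2 = vec_last x k"
    have x12: "x1 \<in> carrier_vec m" "x2 \<in> carrier_vec k" "x1 @\<^sub>v x2 = x"
      using x mn by (auto simp: x1_def x2_def k_def)
    define q where "q = Q *\<^sub>v x1"
    \<comment> \<open>\<open>q\<close> already produces the upper block \<open>x1\<close>, and
      adding a vector \<open>Y r\<close> leaves it alone since \<open>B * Y\<close> is zero.
      Inverting the Gram matrix gives the \<open>r\<close> that corrects the lower block to
      \<open>x2\<close>.\<close>
    define r where "r = H *\<^sub>v (x2 - transpose_mat Y *\<^sub>v q)"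
    have q: "q \<in> carrier_vec n" using Q x12 by (simp add: q_def)
    have r: "r \<in> carrier_vec k" using H Y x12 q by (simp add: r_def)
    have "B *\<^sub>v q = x1"
      unfolding q_def using B Q BQ x12 by (simp flip: assoc_mult_mat_vec[of _ m n _ m])
    then have 1: "B *\<^sub>v (q + Y *\<^sub>v r) = x1"
      using B Y q r x12 by (simp add: mult_add_distrib_mat_vec[OF B] BYv)
    have "transpose_mat Y *\<^sub>v (Y *\<^sub>v r) = x2 - transpose_mat Y *\<^sub>v q"
      unfolding r_def using x12 Y q by (intro YTY) auto
    then have 2: "transpose_mat Y *\<^sub>v (q + Y *\<^sub>v r) = x2"
      using Y q r x12 by (simp add: mult_add_distrib_mat_vec[OF YT]) auto
    show ?thesis
      using 1 2 x12 q r Y by (intro bexI[of _ "q + Y *\<^sub>v r"]) (simp_all add: Kv)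
  qed
  have detK: "det K \<noteq> 0"
  proof -
    have "det (transpose_mat K) \<noteq> 0"
    proof (rule det_nonzeroI_ker)
      show "transpose_mat K \<in> carrier_mat n n" using K by simp
      fix x assume x: "x \<in> carrier_vec n" "transpose_mat K *\<^sub>v x = 0\<^sub>v n"
      obtain v where v: "v \<in> carrier_vec n" "K *\<^sub>v v = x" using K_surj x by blast
      \<comment> \<open>Write one factor as \<open>K v\<close> and move \<open>K\<close> to the
        other side, where its transpose kills \<open>x\<close>.\<close>
      have "scalar_prod x x = 0"
        using transpose_vec_mult_scalar[OF K v(1) x(1)] x v by simp
      then show "x = 0\<^sub>v n" using x by (intro scalar_prod_self_zeroD)
    qed
    then show ?thesis using det_transpose[OF K] by simp
  qed
  have "(\<lambda>v. P *\<^sub>v v) ` carrier_vec n = mat_kernel B"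
  proof (intro equalityI subsetI)
    fix u assume "u \<in> (\<lambda>v. P *\<^sub>v v) ` carrier_vec n"
    then show "u \<in> mat_kernel B"
      using Y H by (auto simp: Pv BYv intro!: mat_kernelI[OF B])
  next
    fix u assume "u \<in> mat_kernel B"
    then have u: "u \<in> carrier_vec n" "B *\<^sub>v u = 0\<^sub>v m" using mat_kernelD[OF B] by auto
    have Pu: "P *\<^sub>v u \<in> carrier_vec n" using P u by simp
    have "B *\<^sub>v (P *\<^sub>v u) = 0\<^sub>v m" using u Y H by (simp add: Pv BYv)
    then have 1: "B *\<^sub>v (u - P *\<^sub>v u) = 0\<^sub>v m"
      using u Pu by (simp add: mult_minus_distrib_mat_vec[OF B])
    have "transpose_mat Y *\<^sub>v (P *\<^sub>v u) = transpose_mat Y *\<^sub>v u"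
      using u P YT YTP by (simp flip: assoc_mult_mat_vec[of _ k n _ n])
    then have 2: "transpose_mat Y *\<^sub>v (u - P *\<^sub>v u) = 0\<^sub>v k"
      using u Pu YT by (simp add: mult_minus_distrib_mat_vec[OF YT])
    have "K *\<^sub>v (u - P *\<^sub>v u) = 0\<^sub>v n"
      using 1 2 u Pu mn by (auto simp: Kv k_def)
    then have "u - P *\<^sub>v u = 0\<^sub>v n"
      using detK det_0_iff_vec_prod_zero[OF K] minus_carrier_vec[OF u(1) Pu] by blast
    then have "u = P *\<^sub>v u"
      using u Pu by (auto simp: vec_eq_iff)
    then show "u \<in> (\<lambda>v. P *\<^sub>v v) ` carrier_vec n" using u by blast
  qed
  then show ?thesis
    using P PP PT unfolding orthogonal_projector_on_def by (simp add: P_def H_def)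
qed

subsection \<open>Characteristic functions of measures on vectors\<close>

lemma space_borel_vec [simp]: "space (borel_vec n) = carrier_vec n"
  by (simp add: borel_vec_def)

lemma measurable_borel_vecI:
  assumes "\<And>x. x \<in> space M \<Longrightarrow> f x \<in> carrier_vec n"
    and "\<And>i. i < n \<Longrightarrow> (\<lambda>x. f x $ i) \<in> borel_measurable M"
  shows "f \<in> measurable M (borel_vec n)"
  unfolding borel_vec_def
proof (rule measurable_vimage_algebra2)
  show "f \<in> space M \<rightarrow> carrier_vec n" using assms(1) by blast
  show "(\<lambda>x. \<lambda>i\<in>{..<n}. f x $ i) \<in> M \<rightarrow>\<^sub>M Pi\<^sub>M {..<n} (\<lambda>_. borel)"
    by (rule measurable_restrict) (simp add: assms(2))
qed

lemma measurable_borel_vec_index: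
  assumes "i < n"
  shows "(\<lambda>v. v $ i) \<in> borel_measurable (borel_vec n)"
proof -
  have *: "(\<lambda>v. \<lambda>i\<in>{..<n}. v $ i) \<in> borel_vec n \<rightarrow>\<^sub>M Pi\<^sub>M {..<n} (\<lambda>_. borel :: real measure)"
    unfolding borel_vec_def by (rule measurable_vimage_algebra1) (auto simp: space_PiM)
  have "(\<lambda>v. (\<lambda>i\<in>{..<n}. v $ i) i) \<in> borel_measurable (borel_vec n)"
    using measurable_compose[OF * measurable_component_singleton[of i]] assms by simp
  then show ?thesis using assms by simp
qed

lemma measurable_scalar_prod_borel_vec:
  assumes "a \<in> carrier_vec n"
  shows "(\<lambda>v. scalar_prod a v) \<in> borel_measurable (borel_vec n)"
proof -
  have "(\<lambda>v. \<Sum>i<n. a $ i * v $ i) \<in> borel_measurable (borel_vec n)"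
    using measurable_borel_vec_index by (intro borel_measurable_sum borel_measurable_times) auto
  then show ?thesis
    by (rule measurable_cong[THEN iffD1, rotated])
       (auto simp: scalar_prod_def lessThan_atLeast0)
qed

text \<open>Dividing by the total mass turns the weights into probability densities. The laws of
  \<open>X\<close> and \<open>X'\<close> under them have equal characteristic functions, so the
  univariate uniqueness theorem applies. The common bound \<open>K\<close> only secures
  integrability.\<close>

lemma weighted_char_eqD:
  fixes w X :: "'a \<Rightarrow> real" and w' X' :: "'b \<Rightarrow> real"
  assumes "finite_measure M" and "finite_measure M'"
    and [measurable]: "w \<in> borel_measurable M" "X \<in> borel_measurable M"
      "w' \<in> borel_measurable M'" "X' \<in> borel_measurable M'"
    and w: "\<And>x. 0 \<le> w x" "\<And>x. w x \<le> K" and w': "\<And>x. 0 \<le> w' x" "\<And>x. w' x \<le> K"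
    and char: "\<And>t. (CLINT x|M. w x * iexp (t * X x)) = (CLINT x|M'. w' x * iexp (t * X' x))"
    and B[measurable]: "B \<in> sets borel"
  shows "(LINT x|M. w x * indicator B (X x)) = (LINT x|M'. w' x * indicator B (X' x))"
proof -
  interpret M: finite_measure M by fact
  interpret M': finite_measure M' by fact
  have int: "integrable M w" "integrable M' w'"
    using w w' by (auto intro!: M.integrable_const_bound[of _ K] M'.integrable_const_bound[of _ K])
  define c where "c = (LINT x|M. w x)"
  have "complex_of_real (LINT x|M. w x) = of_real (LINT x|M'. w' x)"
    \<comment> \<open>At frequency 0 the hypothesis compares the total masses.\<close>
    using char[of 0] by (simp flip: integral_complex_of_real)
  then have c': "(LINT x|M'. w' x) = c" by (simp add: c_def)
  have c0: "0 \<le> c" unfolding c_def using w by simp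
  show ?thesis
  proof (cases "c = 0")
    \<comment> \<open>Total mass zero cannot be normalised, but then both weights vanish almost
      everywhere.\<close>
    case True
    have "AE x in M. w x = 0"
      using True int w by (simp add: c_def integral_nonneg_eq_0_iff_AE)
    moreover have "AE x in M'. w' x = 0"
      using True c' int w' by (simp add: integral_nonneg_eq_0_iff_AE)
    ultimately
    have "(LINT x|M. w x * indicator B (X x)) = 0" "(LINT x|M'. w' x * indicator B (X' x)) = 0"
      by (auto intro!: integral_eq_zero_AE)
    then show ?thesis by simp
  next
    case False
    with c0 have c: "0 < c" by simp
    define D where "D = distr (density M (\<lambda>x. w x / c)) borel X"
    define D' where "D' = distr (density M' (\<lambda>x. w' x / c)) borel X'"
    have nn: "(\<integral>\<^sup>+x. ennreal (w x / c) \<partial>M) = 1"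
      using c w int by (subst nn_integral_eq_integral) (auto simp: c_def)
    have nn': "(\<integral>\<^sup>+x. ennreal (w' x / c) \<partial>M') = 1"
      using c w' int c' by (subst nn_integral_eq_integral) (auto simp: c_def)
    have "prob_space D" unfolding D_def
      by (rule prob_space.prob_space_distr, rule prob_spaceI)
         (auto simp: emeasure_density nn cong: nn_integral_cong)
    moreover have "prob_space D'" unfolding D'_def
      by (rule prob_space.prob_space_distr, rule prob_spaceI)
         (auto simp: emeasure_density nn' cong: nn_integral_cong)
    ultimately have rd: "real_distribution D" "real_distribution D'"
      by (auto simp: real_distribution_def real_distribution_axioms_def D_def D'_def)
    have "char D t = char D' t" for t
    proof -
      have "char D t = (CLINT x|M. (w x / c) *\<^sub>R iexp (t * X x))"
        unfolding char_def D_def using w c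
        by (subst integral_distr) (auto intro!: integral_density)
      also have "\<dots> = (CLINT x|M. w x * iexp (t * X x)) / c"
        by (simp add: scaleR_conv_of_real)
      also have "\<dots> = (CLINT x|M'. (w' x / c) *\<^sub>R iexp (t * X' x))"
        unfolding char by (simp add: scaleR_conv_of_real)
      also have "\<dots> = char D' t"
        unfolding char_def D'_def using w' c
        by (subst integral_distr) (auto intro!: integral_density[symmetric])
      finally show ?thesis .
    qed
    then have DD: "D = D'"
      by (intro Levy_uniqueness rd) auto
    have "(LINT x|M. w x * indicator B (X x)) = c * (LINT y|D. indicator B y)"
      unfolding D_def using w c
      by (subst integral_distr) (auto simp: integral_density)
    also have "\<dots> = (LINT x|M'. w' x * indicator B (X' x))"
      unfolding DD D'_def using w' c
      by (subst integral_distr) (auto simp: integral_density)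
    finally show ?thesis .
  qed
qed

text \<open>Boxes determine a finite measure on the product sigma-algebra. This carries over to
  vectors because every set of \<open>borel_vec n\<close> is a preimage under the coordinate
  map.\<close>

lemma borel_vec_eqI_box:
  assumes N: "prob_space N" "sets N = sets (borel_vec n)" and N': "prob_space N'" "sets N' = sets (borel_vec n)"
    and eq: "\<And>A. (\<And>i. i < n \<Longrightarrow> A i \<in> sets borel) \<Longrightarrow>
      measure N {v \<in> carrier_vec n. \<forall>i<n. v $ i \<in> A i} = measure N' {v \<in> carrier_vec n. \<forall>i<n. v $ i \<in> A i}"
  shows "N = N'"
proof -
  interpret N: prob_space N by fact
  interpret N': prob_space N' by fact
  let ?f = "\<lambda>v. \<lambda>i\<in>{..<n}. v $ i"
  let ?P = "Pi\<^sub>M {..<n} (\<lambda>_. borel :: real measure)"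
  have f0: "?f \<in> borel_vec n \<rightarrow>\<^sub>M ?P"
    unfolding borel_vec_def by (rule measurable_vimage_algebra1) (auto simp: space_PiM)
  have f: "?f \<in> N \<rightarrow>\<^sub>M ?P" "?f \<in> N' \<rightarrow>\<^sub>M ?P"
    using f0 N(2) N'(2) by (simp_all cong: measurable_cong_sets)
  have sp: "space N = carrier_vec n" "space N' = carrier_vec n"
    using sets_eq_imp_space_eq[OF N(2)] sets_eq_imp_space_eq[OF N'(2)] by auto
  have "distr N ?P ?f = distr N' ?P ?f"
  proof (rule measure_eqI_PiM_finite[where I = "{..<n}" and M = "\<lambda>_. borel" and A = "\<lambda>_. space ?P"])
    fix A :: "nat \<Rightarrow> real set" assume A: "\<And>i. i \<in> {..<n} \<Longrightarrow> A i \<in> sets borel"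
    then have A': "Pi\<^sub>E {..<n} A \<in> sets ?P" by (intro sets_PiM_I_finite) auto
    have "?f -` Pi\<^sub>E {..<n} A \<inter> carrier_vec n = {v \<in> carrier_vec n. \<forall>i<n. v $ i \<in> A i}"
      unfolding vimage_def restrict_PiE_iff by auto
    then show "emeasure (distr N ?P ?f) (Pi\<^sub>E {..<n} A) = emeasure (distr N' ?P ?f) (Pi\<^sub>E {..<n} A)"
      using A A' f eq[of A] by (simp add: emeasure_distr sp N.emeasure_eq_measure N'.emeasure_eq_measure)
  next
    show "range (\<lambda>_. space ?P) \<subseteq> prod_algebra {..<n} (\<lambda>_. borel)"
      by (auto simp: space_PiM intro!: prod_algebraI_finite)
    show "emeasure (distr N ?P ?f) (space ?P) \<noteq> \<infinity>"
      using f(1) by (subst emeasure_distr) (simp_all add: N.emeasure_eq_measure)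
  qed auto
  note distr_eq = this
  show ?thesis
  proof (rule measure_eqI)
    fix S assume S: "S \<in> sets N"
    then obtain T where T: "T \<in> sets ?P" "S = ?f -` T \<inter> carrier_vec n"
      unfolding N(2) borel_vec_def by (subst (asm) sets_vimage_algebra2) (auto simp: space_PiM)
    have "emeasure N S = emeasure (distr N ?P ?f) T"
      using T f by (simp add: emeasure_distr sp)
    also have "\<dots> = emeasure N' S"
      unfolding distr_eq using T f by (simp add: emeasure_distr sp)
    finally show "emeasure N S = emeasure N' S" .
  qed (simp add: N N')
qed

text \<open>Euler's formula: a trigonometric weight in front of a one-dimensional exponential
  becomes a combination of plain exponentials. The frequencies are written \<open>0 + y\<close>,
  \<open>x + y\<close> and \<open>- x + y\<close> to match the shifted linear forms of the induction
  below; the sine version does the same.\<close>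

lemma one_plus_cos_mult_iexp:
  "complex_of_real (w * (1 + cos x)) * iexp y = w * iexp (0 + y) + w * iexp (x + y) / 2 + w * iexp (- x + y) / 2"
  unfolding cis_conv_exp[symmetric]
  by (simp add: complex_eq_iff cos_add sin_add cos_diff sin_diff algebra_simps add_divide_distrib diff_divide_distrib)

lemma one_plus_sin_mult_iexp:
  "complex_of_real (w * (1 + sin x)) * iexp y = w * iexp (0 + y) + \<i> / 2 * (w * iexp (- x + y)) - \<i> / 2 * (w * iexp (x + y))"
  unfolding cis_conv_exp[symmetric]
  by (simp add: complex_eq_iff cos_add sin_add cos_diff sin_diff algebra_simps add_divide_distrib diff_divide_distrib)

text \<open>Reduction to one dimension: coordinate by coordinate, a factor of the exponential is replaced by an
  indicator function. Since the univariate theorem is about measures, the cosine and the sine of the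
  remaining exponent enter as the nonnegative weights 1 + cos and 1 + sin.\<close>

lemma borel_vec_eqI_char:
  assumes N: "prob_space N" "sets N = sets (borel_vec n)" and N': "prob_space N'" "sets N' = sets (borel_vec n)"
    and char: "\<And>a. a \<in> carrier_vec n \<Longrightarrow>
      (CLINT v|N. iexp (scalar_prod a v)) = (CLINT v|N'. iexp (scalar_prod a v))"
  shows "N = N'"
proof (rule borel_vec_eqI_box[OF N N'])
  fix A :: "nat \<Rightarrow> real set" assume A: "\<And>i. i < n \<Longrightarrow> A i \<in> sets borel"
  \<comment> \<open>The coefficients form a function, so that a single one can be changed by a
    function update.\<close>
  define e where "e s v = (\<Sum>i<n. s i * v $ i)" for s :: "nat \<Rightarrow> real" and v :: "real vec"
  define ind where "ind J v = (\<Prod>j\<in>J. indicator (A j) (v $ j) :: real)" for J and v :: "real vec"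
  have ind01: "0 \<le> ind J v" "ind J v \<le> 1" for J v
    by (auto simp: ind_def intro!: prod_nonneg prod_le_1)
  have e_upd: "e (s(k := s k + t)) v = e s v + t * v $ k" if "k < n" for s k t v
  proof -
    have "e (s(k := s k + t)) v = (\<Sum>i<n. s i * v $ i + (if i = k then t * v $ k else 0))"
      unfolding e_def by (intro sum.cong) (auto simp: algebra_simps)
    then show ?thesis using that by (simp add: e_def sum.distrib)
  qed
  have e_uminus: "e (\<lambda>i. - s i) v = - e s v" for s v
    by (simp add: e_def sum_negf)
  have e_zero: "e (\<lambda>i. 0) v = 0" for v by (simp add: e_def)

  have e_meas: "e s \<in> borel_measurable D" if "sets D = sets (borel_vec n)" for D s
    unfolding e_def measurable_cong_sets[OF that refl]
    using measurable_borel_vec_index by (intro borel_measurable_sum borel_measurable_times) auto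
  have i_meas: "(\<lambda>v. v $ i) \<in> borel_measurable D" if "sets D = sets (borel_vec n)" "i < n" for D i
    unfolding measurable_cong_sets[OF that(1) refl] by (rule measurable_borel_vec_index) fact
  have ind_meas: "ind J \<in> borel_measurable D" if "sets D = sets (borel_vec n)" "J \<subseteq> {..<n}" for D J
    unfolding ind_def using that A i_meas[OF that(1)]
    by (intro borel_measurable_prod measurable_compose[of _ D borel, OF _ borel_measurable_indicator]) auto

  \<comment> \<open>\<open>F\<close> interpolates between the characteristic function
    (\<open>J\<close> empty) and the probability of the box (\<open>J\<close> all coordinates,
    \<open>s\<close> zero). The exponent keeps the coordinates in \<open>J\<close>, so each step
    merely inserts an indicator.\<close>
  define F where "F D J s = (CLINT v|D. ind J v * iexp (e s v))" for D J s
  have F_int: "integrable D (\<lambda>v. ind J v * iexp (e s v))"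
    if D: "prob_space D" "sets D = sets (borel_vec n)" and J: "J \<subseteq> {..<n}" for D J s
  proof -
    interpret prob_space D by fact
    note [measurable] = e_meas[OF D(2)] ind_meas[OF D(2) J]
    show ?thesis
      using ind01 by (intro integrable_const_bound[of _ 1]) (auto simp: norm_mult)
  qed
  have real_int: "integrable D (\<lambda>v. ind J v * h v * indicator B (v $ k))"
    if D: "prob_space D" "sets D = sets (borel_vec n)" and J: "J \<subseteq> {..<n}" and k: "k < n" and B: "B \<in> sets borel"
      and h[measurable]: "h \<in> borel_measurable D" and h2: "\<And>v. \<bar>h v\<bar> \<le> 2" for D J k B and h :: "real vec \<Rightarrow> real"
  proof -
    interpret prob_space D by fact
    note [measurable] = i_meas[OF D(2) k] ind_meas[OF D(2) J] B
    have "\<bar>ind J v * h v * indicator B (v $ k)\<bar> \<le> 1 * 2 * 1" for v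
      unfolding abs_mult using ind01[of J v] h2[of v] by (intro mult_mono) (auto simp: indicator_def)
    then show ?thesis
      by (intro integrable_const_bound[of _ 2]) auto
  qed

  \<comment> \<open>The coefficients \<open>s\<close> must stay arbitrary: a step for
    \<open>s\<close> uses the induction hypothesis at 0, s and -s, each with its entry at
    \<open>k\<close> shifted by \<open>t\<close>.\<close>
  have main: "F N J s = F N' J s" if "finite J" "J \<subseteq> {..<n}" for J s
    using that
  proof (induction J arbitrary: s)
    case empty
    have sp: "space N = carrier_vec n" "space N' = carrier_vec n"
      using sets_eq_imp_space_eq[OF N(2)] sets_eq_imp_space_eq[OF N'(2)] by auto
    have ev: "e s v = scalar_prod (vec n s) v" if "v \<in> carrier_vec n" for v
      using that by (auto simp: e_def scalar_prod_def lessThan_atLeast0)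
    have "F N {} s = (CLINT v|N. iexp (scalar_prod (vec n s) v))"
      unfolding F_def by (intro Bochner_Integration.integral_cong) (auto simp: ind_def ev sp)
    also have "\<dots> = (CLINT v|N'. iexp (scalar_prod (vec n s) v))"
      by (rule char) simp
    also have "\<dots> = F N' {} s"
      unfolding F_def by (intro Bochner_Integration.integral_cong) (auto simp: ind_def ev sp)
    finally show ?case .
  next
    case (insert k J)
    then have k: "k < n" and J: "J \<subseteq> {..<n}" by auto
    note IH = insert.IH[OF J]
    define T where "T s t = s(k := s k + t)" for s :: "nat \<Rightarrow> real" and t
    have eT: "e (T s t) v = e s v + t * v $ k" for s t v
      unfolding T_def by (rule e_upd[OF k])
    have cos_char: "(CLINT v|D. complex_of_real (ind J v * (1 + cos (e s v))) * iexp (t * v $ k)) =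
        F D J (T (\<lambda>_. 0) t) + F D J (T s t) / 2 + F D J (T (\<lambda>i. - s i) t) / 2"
      and sin_char: "(CLINT v|D. complex_of_real (ind J v * (1 + sin (e s v))) * iexp (t * v $ k)) =
        F D J (T (\<lambda>_. 0) t) + \<i> / 2 * F D J (T (\<lambda>i. - s i) t) - \<i> / 2 * F D J (T s t)"
      and one_char: "(CLINT v|D. complex_of_real (ind J v * 1) * iexp (t * v $ k)) = F D J (T (\<lambda>_. 0) t)"
      if D: "prob_space D" "sets D = sets (borel_vec n)" for D t
    proof -
      note int = F_int[OF D J]
      have "(CLINT v|D. complex_of_real (ind J v * (1 + cos (e s v))) * iexp (t * v $ k)) =
        (CLINT v|D. ind J v * iexp (e (T (\<lambda>_. 0) t) v) + ind J v * iexp (e (T s t) v) / 2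
          + ind J v * iexp (e (T (\<lambda>i. - s i) t) v) / 2)"
        unfolding eT one_plus_cos_mult_iexp e_uminus e_zero by simp
      then show "(CLINT v|D. complex_of_real (ind J v * (1 + cos (e s v))) * iexp (t * v $ k)) =
          F D J (T (\<lambda>_. 0) t) + F D J (T s t) / 2 + F D J (T (\<lambda>i. - s i) t) / 2"
        using int by (simp add: F_def)
      have "(CLINT v|D. complex_of_real (ind J v * (1 + sin (e s v))) * iexp (t * v $ k)) =
        (CLINT v|D. ind J v * iexp (e (T (\<lambda>_. 0) t) v) + \<i> / 2 * (ind J v * iexp (e (T (\<lambda>i. - s i) t) v))
          - \<i> / 2 * (ind J v * iexp (e (T s t) v)))"
        unfolding eT one_plus_sin_mult_iexp e_uminus e_zero by simp
      then show "(CLINT v|D. complex_of_real (ind J v * (1 + sin (e s v))) * iexp (t * v $ k)) =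
        F D J (T (\<lambda>_. 0) t) + \<i> / 2 * F D J (T (\<lambda>i. - s i) t) - \<i> / 2 * F D J (T s t)"
        using int by (simp add: F_def)
      show "(CLINT v|D. complex_of_real (ind J v * 1) * iexp (t * v $ k)) = F D J (T (\<lambda>_. 0) t)"
        unfolding F_def eT e_zero by simp
    qed
    \<comment> \<open>The weight is at most 2, as the indicators are at most 1 and \<open>h\<close>
      is at most 2.\<close>
    have transfer: "(LINT v|N. ind J v * h v * indicator (A k) (v $ k)) = (LINT v|N'. ind J v * h v * indicator (A k) (v $ k))"
      if h: "\<And>D. sets D = sets (borel_vec n) \<Longrightarrow> h \<in> borel_measurable D" "\<And>v. 0 \<le> h v" "\<And>v. h v \<le> 2"
      and char: "\<And>t. (CLINT v|N. complex_of_real (ind J v * h v) * iexp (t * v $ k)) =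
        (CLINT v|N'. complex_of_real (ind J v * h v) * iexp (t * v $ k))" for h :: "real vec \<Rightarrow> real"
    proof (rule weighted_char_eqD[where K = 2])
      show "finite_measure N" "finite_measure N'"
        using N N' by (auto simp: prob_space_def)
      show "ind J v * h v \<le> 2" "ind J v * h v \<le> 2" for v
        using mult_mono[OF ind01(2)[of J v] h(3)[of v]] h(2) by auto
      show "(CLINT v|N. complex_of_real (ind J v * h v) * iexp (t * v $ k)) =
        (CLINT v|N'. complex_of_real (ind J v * h v) * iexp (t * v $ k))" for t by (rule char)
    qed (use N(2) N'(2) J k A in \<open>auto intro!: borel_measurable_times ind_meas i_meas h mult_nonneg_nonneg ind01\<close>)
    have h_meas: "(\<lambda>v. 1 + cos (e s v)) \<in> borel_measurable D" "(\<lambda>v. 1 + sin (e s v)) \<in> borel_measurable D"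
      if D: "sets D = sets (borel_vec n)" for D
    proof -
      have [measurable]: "e s \<in> borel_measurable D" by (rule e_meas) fact
      show "(\<lambda>v. 1 + cos (e s v)) \<in> borel_measurable D" "(\<lambda>v. 1 + sin (e s v)) \<in> borel_measurable D"
        by simp_all
    qed
    have bounds: "0 \<le> 1 + cos x" "1 + cos x \<le> 2" "0 \<le> 1 + sin x" "1 + sin x \<le> 2" for x :: real
      using cos_ge_minus_one[of x] cos_le_one[of x] sin_ge_minus_one[of x] sin_le_one[of x] by linarith+
    have eq_cos: "(LINT v|N. ind J v * (1 + cos (e s v)) * indicator (A k) (v $ k)) =
        (LINT v|N'. ind J v * (1 + cos (e s v)) * indicator (A k) (v $ k))"
      by (rule transfer) (simp_all only: h_meas bounds cos_char[OF N] cos_char[OF N'] IH)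
    have eq_sin: "(LINT v|N. ind J v * (1 + sin (e s v)) * indicator (A k) (v $ k)) =
        (LINT v|N'. ind J v * (1 + sin (e s v)) * indicator (A k) (v $ k))"
      by (rule transfer) (simp_all only: h_meas bounds sin_char[OF N] sin_char[OF N'] IH)
    have eq_one: "(LINT v|N. ind J v * 1 * indicator (A k) (v $ k)) =
        (LINT v|N'. ind J v * 1 * indicator (A k) (v $ k))"
      by (rule transfer) (simp_all only: one_char[OF N] one_char[OF N'] IH, simp_all)
    define C where "C D = complex_of_real (LINT v|D. ind J v * (1 + cos (e s v)) * indicator (A k) (v $ k))" for D
    define S where "S D = complex_of_real (LINT v|D. ind J v * (1 + sin (e s v)) * indicator (A k) (v $ k))" for D
    define U where "U D = complex_of_real (LINT v|D. ind J v * 1 * indicator (A k) (v $ k))" for D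
    \<comment> \<open>Undoes the shift that made the weights nonnegative: the exponential is (1 +
      cos) - 1 plus \<i> times (1 + sin) - 1, which is why the constant weight 1 is transferred as
      well.\<close>
    have F_ins: "F D (insert k J) s = (C D - U D) + \<i> * (S D - U D)"
      if D: "prob_space D" "sets D = sets (borel_vec n)" for D
    proof -
      have int: "integrable D (\<lambda>v. complex_of_real (ind J v * (1 + cos (e s v)) * indicator (A k) (v $ k)))"
        "integrable D (\<lambda>v. complex_of_real (ind J v * (1 + sin (e s v)) * indicator (A k) (v $ k)))"
        "integrable D (\<lambda>v. complex_of_real (ind J v * 1 * indicator (A k) (v $ k)))"
        using A[OF k] bounds h_meas[OF D(2)] by (intro integrable_of_real real_int[OF D J k]; simp)+
      have "F D (insert k J) s = (CLINT v|D. 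
        (complex_of_real (ind J v * (1 + cos (e s v)) * indicator (A k) (v $ k)) - complex_of_real (ind J v * 1 * indicator (A k) (v $ k)))
        + \<i> * (complex_of_real (ind J v * (1 + sin (e s v)) * indicator (A k) (v $ k)) - complex_of_real (ind J v * 1 * indicator (A k) (v $ k))))"
        unfolding F_def using insert.hyps
        by (intro Bochner_Integration.integral_cong)
          (simp_all add: ind_def cis_conv_exp[symmetric] complex_eq_iff algebra_simps)
      also have "\<dots> = (C D - U D) + \<i> * (S D - U D)"
        unfolding C_def S_def U_def integral_complex_of_real[symmetric] using int
        by (simp del: of_real_mult of_real_add mult_1_right)
      finally show ?thesis .
    qed
    show ?case
      unfolding F_ins[OF N] F_ins[OF N'] C_def S_def U_def eq_cos eq_sin eq_one ..
  qed

  have box: "complex_of_real (measure D {v \<in> carrier_vec n. \<forall>i<n. v $ i \<in> A i}) = F D {..<n} (\<lambda>_. 0)"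
    if D: "prob_space D" "sets D = sets (borel_vec n)" for D
  proof -
    have sp: "space D = carrier_vec n" using sets_eq_imp_space_eq[OF D(2)] by simp
    let ?S = "{v \<in> carrier_vec n. \<forall>i<n. v $ i \<in> A i}"
    have ind: "ind {..<n} v = indicator ?S v" if "v \<in> carrier_vec n" for v
      using that by (auto simp: ind_def indicator_def prod_zero_iff)
    have "F D {..<n} (\<lambda>_. 0) = complex_of_real (LINT v|D. ind {..<n} v)"
      unfolding F_def by (simp add: e_zero)
    also have "(LINT v|D. ind {..<n} v) = (LINT v|D. indicator ?S v)"
      by (intro Bochner_Integration.integral_cong) (simp_all add: ind sp)
    also have "\<dots> = measure D ?S"
      using sp by (simp add: Int_absorb2 subset_iff)
    finally show ?thesis ..
  qed
  have "complex_of_real (measure N {v \<in> carrier_vec n. \<forall>i<n. v $ i \<in> A i}) =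
      complex_of_real (measure N' {v \<in> carrier_vec n. \<forall>i<n. v $ i \<in> A i})"
    unfolding box[OF N] box[OF N'] by (rule main) auto
  then show "measure N {v \<in> carrier_vec n. \<forall>i<n. v $ i \<in> A i} = measure N' {v \<in> carrier_vec n. \<forall>i<n. v $ i \<in> A i}"
    by simp
qed

subsection \<open>Gaussian vectors\<close>

lemma quadratic_form_congruence:
  fixes K S :: "real mat"
  assumes K: "K \<in> carrier_mat k n" and S: "S \<in> carrier_mat n n" and a: "a \<in> carrier_vec k"
  shows "scalar_prod a ((K * S * transpose_mat K) *\<^sub>v a) =
    scalar_prod (transpose_mat K *\<^sub>v a) (S *\<^sub>v (transpose_mat K *\<^sub>v a))"
proof -
  have "(K * S * transpose_mat K) *\<^sub>v a = K *\<^sub>v (S *\<^sub>v (transpose_mat K *\<^sub>v a))"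
    using assms by (simp add: assoc_mult_mat_vec[of _ k n _ k] assoc_mult_mat_vec[of _ k n _ n])
  then show ?thesis
    using assms transpose_vec_mult_scalar[OF K, of "S *\<^sub>v (transpose_mat K *\<^sub>v a)" a] by simp
qed

lemma sym_psd_congruence:
  assumes K: "K \<in> carrier_mat k n" and S: "sym_psd n S"
  shows "sym_psd k (K * S * transpose_mat K)"
proof -
  have S': "S \<in> carrier_mat n n" "transpose_mat S = S" using S by (auto simp: sym_psd_def)
  have "transpose_mat (K * S * transpose_mat K) = K * transpose_mat (K * S)"
    using K S' by (subst transpose_mult[of _ k n _ k]) auto
  also have "transpose_mat (K * S) = S * transpose_mat K"
    using K S' by (subst transpose_mult[of _ k n _ n]) auto
  also have "K * (S * transpose_mat K) = K * S * transpose_mat K"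
    using K S' by (intro assoc_mult_mat[symmetric]) auto
  finally have "transpose_mat (K * S * transpose_mat K) = K * S * transpose_mat K" .
  moreover have "0 \<le> scalar_prod a ((K * S * transpose_mat K) *\<^sub>v a)" if "a \<in> carrier_vec k" for a
    using that K S by (simp add: quadratic_form_congruence[OF K S'(1)] sym_psd_def)
  ultimately show ?thesis using K S' by (auto simp: sym_psd_def)
qed

lemma measurable_mult_mat_vec_borel_vec:
  assumes K: "K \<in> carrier_mat k n"
  shows "(\<lambda>v. K *\<^sub>v v) \<in> borel_vec n \<rightarrow>\<^sub>M borel_vec k"
proof (rule measurable_borel_vecI)
  fix i assume "i < k"
  then have "(\<lambda>v. scalar_prod (row K i) v) \<in> borel_measurable (borel_vec n)"
    using K by (intro measurable_scalar_prod_borel_vec) auto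
  then show "(\<lambda>v. (K *\<^sub>v v) $ i) \<in> borel_measurable (borel_vec n)"
    using K \<open>i < k\<close> by simp
qed (use K in auto)

lemma measurable_add_borel_vec:
  assumes f: "f \<in> M \<rightarrow>\<^sub>M borel_vec n" and g: "g \<in> M \<rightarrow>\<^sub>M borel_vec n"
  shows "(\<lambda>x. f x + g x) \<in> M \<rightarrow>\<^sub>M borel_vec n"
proof (rule measurable_borel_vecI)
  show "f x + g x \<in> carrier_vec n" if "x \<in> space M" for x
    using measurable_space[OF f that] measurable_space[OF g that] by simp
next
  fix i assume i: "i < n"
  have "(\<lambda>x. f x $ i + g x $ i) \<in> borel_measurable M"
    using measurable_compose[OF f measurable_borel_vec_index[OF i]]
      measurable_compose[OF g measurable_borel_vec_index[OF i]] by (rule borel_measurable_add)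
  then show "(\<lambda>x. (f x + g x) $ i) \<in> borel_measurable M"
    using i carrier_vecD[OF measurable_space[OF g, simplified]] by (subst measurable_cong[of _ _ "\<lambda>x. f x $ i + g x $ i"]) auto
qed

text \<open>Continuity here is sequential and confined to \<open>carrier_vec n\<close>. Composing
  with \<open>vec n\<close> moves it to functions on the naturals with the product topology, where
  continuity implies Borel measurability; padding a vector with zeros leads back.\<close>

lemma continuous_vec_measurable:
  assumes "continuous_vec n f"
  shows "f \<in> borel_measurable (borel_vec n)"
proof -
  define g where "g h = f (vec n h)" for h :: "nat \<Rightarrow> real"
  have "continuous_on UNIV g"
  proof (rule continuous_on_sequentiallyI)
    fix u :: "nat \<Rightarrow> nat \<Rightarrow> real" and a assume u: "u \<longlonglongrightarrow> a"
    have "(\<lambda>k. u k i) \<longlonglongrightarrow> a i" for i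
      using continuous_on_tendsto_compose[OF continuous_on_product_coordinates[of i] u] by simp
    then have "vec_tendsto n (\<lambda>k. vec n (u k)) (vec n a)"
      by (simp add: vec_tendsto_def)
    then show "(\<lambda>k. g (u k)) \<longlonglongrightarrow> g a"
      using assms by (simp add: g_def continuous_vec_def)
  qed
  then have "g \<in> borel_measurable borel" by (rule borel_measurable_continuous_onI)
  moreover have "(\<lambda>v i. if i < n then v $ i else 0) \<in> borel_measurable (borel_vec n)"
  proof (rule measurable_coordinatewise_then_product)
    show "(\<lambda>v. if i < n then v $ i else 0) \<in> borel_measurable (borel_vec n)" for i
      using measurable_borel_vec_index[of i n] by (cases "i < n") auto
  qed
  ultimately have "(\<lambda>v. g (\<lambda>i. if i < n then v $ i else 0)) \<in> borel_measurable (borel_vec n)"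
    by (rule measurable_compose[rotated])
  moreover have "g (\<lambda>i. if i < n then v $ i else 0) = f v" if "v \<in> carrier_vec n" for v
  proof -
    have "vec n (\<lambda>i. if i < n then v $ i else 0) = v" using that by auto
    then show ?thesis by (simp add: g_def)
  qed
  ultimately show ?thesis by (subst measurable_cong[where g = "\<lambda>v. g (\<lambda>i. if i < n then v $ i else 0)"]) auto
qed

section \<open>Univariate normal laws, with point masses for variance zero\<close>

lemma prob_space_normal_real: "prob_space (normal_real \<mu> v)"
  by (auto simp: normal_real_def intro!: prob_space_normal_density prob_space_return)

lemma sets_normal_real [simp, measurable_cong]: "sets (normal_real \<mu> v) = sets borel"
  by (simp add: normal_real_def)

lemma space_normal_real [simp]: "space (normal_real \<mu> v) = UNIV"
  by (simp add: normal_real_def)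

text \<open>Serves affine images of Gaussian vectors: the linear part of the map is absorbed into
  the functional, which leaves a translation on the real line.\<close>

lemma distr_normal_real_add: "distr (normal_real \<mu> v) borel (\<lambda>x. c + x) = normal_real (c + \<mu>) v"
proof (cases "0 < v")
  case True
  let ?N = "density lborel (\<lambda>x. ennreal (normal_density \<mu> (sqrt v) x))"
  interpret prob_space ?N by (rule prob_space_normal_density) (simp add: True)
  have "distributed ?N lborel (\<lambda>x. x) (normal_density \<mu> (sqrt v))"
    by (auto simp: distributed_def intro!: distr_id2)
  from normal_density_affine[OF this, of 1 c] True show ?thesis
    by (simp add: normal_real_def distributed_def cong: distr_cong)
next
  case False
  then show ?thesis by (simp add: normal_real_def distr_return)
qed

text \<open>Standardisation for positive variance, direct evaluation for a point mass. That one
  formula covers both is what lets singular covariances pass through the characteristic function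
  arguments without case distinctions.\<close>

lemma char_normal_real:
  assumes "0 \<le> v"
  shows "char (normal_real \<mu> v) t = exp (\<i> * (t * \<mu>) - t\<^sup>2 * v / 2)"
proof (cases "0 < v")
  case True
  let ?N = "density lborel (\<lambda>x. ennreal (normal_density \<mu> (sqrt v) x))"
  let ?\<sigma> = "sqrt v"
  interpret prob_space ?N by (rule prob_space_normal_density) (simp add: True)
  have "distributed ?N lborel (\<lambda>x. x) (normal_density \<mu> (sqrt v))"
    by (auto simp: distributed_def intro!: distr_id2)
  then have "distr ?N lborel (\<lambda>x. (x - \<mu>) / ?\<sigma>) = std_normal_distribution"
    using normal_standard_normal_convert[of ?\<sigma> "\<lambda>x. x" \<mu>] True by (simp add: distributed_def)
  \<comment> \<open>At the argument \<open>t * ?\<sigma>\<close> the scaling cancels and only the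
    shift by \<open>t * \<mu>\<close> remains.\<close>
  then have "char std_normal_distribution (t * ?\<sigma>) = (CLINT x|?N. iexp (t * ?\<sigma> * ((x - \<mu>) / ?\<sigma>)))"
    by (simp only: char_def flip: \<open>distr ?N lborel _ = _\<close>) (subst integral_distr; simp)
  also have "(\<lambda>x. t * ?\<sigma> * ((x - \<mu>) / ?\<sigma>)) = (\<lambda>x. t * x - t * \<mu>)"
    using True by (simp add: fun_eq_iff field_simps)
  also have "(CLINT x|?N. iexp (t * x - t * \<mu>)) = (CLINT x|?N. iexp (t * x) / iexp (t * \<mu>))"
    by (simp add: right_diff_distrib exp_diff)
  also have "\<dots> = (CLINT x|?N. iexp (t * x)) / iexp (t * \<mu>)" by simp
  finally have "(CLINT x|?N. iexp (t * x)) = iexp (t * \<mu>) * complex_of_real (exp (- (t\<^sup>2 * v / 2)))"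
    using True by (simp add: char_std_normal_distribution field_simps)
  then show ?thesis using True by (simp add: char_def normal_real_def flip: exp_add exp_of_real)
next
  case False
  with assms show ?thesis by (simp add: char_def normal_real_def integral_return)
qed

section \<open>Multivariate Gaussian laws through their linear functionals\<close>

text \<open>Total mass 1 is not part of the definition. It follows from the zero functional, whose
  law under \<open>N\<close> is required to be a point mass.\<close>

lemma is_gaussianD:
  assumes "is_gaussian n \<mu> S N"
  shows "\<mu> \<in> carrier_vec n" "S \<in> carrier_mat n n" "sym_psd n S" "sets N = sets (borel_vec n)"
    "space N = carrier_vec n" "prob_space N"
proof -
  have distr: "distr N borel (\<lambda>x. scalar_prod (0\<^sub>v n) x) = normal_real (scalar_prod (0\<^sub>v n) \<mu>) (scalar_prod (0\<^sub>v n) (S *\<^sub>v 0\<^sub>v n))"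
    using assms by (simp add: is_gaussian_def)
  show N: "sets N = sets (borel_vec n)" using assms by (simp add: is_gaussian_def)
  show "space N = carrier_vec n" using sets_eq_imp_space_eq[OF N] by simp
  show "\<mu> \<in> carrier_vec n" "S \<in> carrier_mat n n" "sym_psd n S"
    using assms by (auto simp: is_gaussian_def sym_psd_def)
  show "prob_space N"
  proof (rule prob_space_distrD)
    show "(\<lambda>x. scalar_prod (0\<^sub>v n) x) \<in> borel_measurable N"
      unfolding measurable_cong_sets[OF N refl] by (rule measurable_scalar_prod_borel_vec) simp
    show "prob_space (distr N borel (\<lambda>x. scalar_prod (0\<^sub>v n) x))"
      unfolding distr by (rule prob_space_normal_real)
  qed
qed

lemma is_gaussian_char:
  assumes N: "is_gaussian n \<mu> S N" and a: "a \<in> carrier_vec n"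
  shows "(CLINT v|N. iexp (scalar_prod a v)) = exp (\<i> * scalar_prod a \<mu> - scalar_prod a (S *\<^sub>v a) / 2)"
proof -
  have [measurable]: "(\<lambda>x. scalar_prod a x) \<in> borel_measurable N"
    unfolding measurable_cong_sets[OF is_gaussianD(4)[OF N] refl] by (rule measurable_scalar_prod_borel_vec) fact
  have "(CLINT v|N. iexp (scalar_prod a v)) = char (distr N borel (\<lambda>x. scalar_prod a x)) 1"
    unfolding char_def by (subst integral_distr) auto
  also have "\<dots> = exp (\<i> * scalar_prod a \<mu> - scalar_prod a (S *\<^sub>v a) / 2)"
    using N a by (simp add: is_gaussian_def char_normal_real sym_psd_def)
  finally show ?thesis .
qed

text \<open>A functional \<open>a\<close> of the image is the constant \<open>a . c\<close> plus the
  functional \<open>K^T a\<close> of the original vector, so the defining property of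
  \<open>N\<close> at \<open>K^T a\<close> suffices, for any \<open>K\<close>, singular or not
  square.\<close>

lemma is_gaussian_affine:
  assumes N: "is_gaussian n \<mu> S N" and K: "K \<in> carrier_mat k n" and c: "c \<in> carrier_vec k"
  shows "is_gaussian k (c + K *\<^sub>v \<mu>) (K * S * transpose_mat K) (distr N (borel_vec k) (\<lambda>v. c + K *\<^sub>v v))"
proof -
  note N' = is_gaussianD[OF N]
  have f: "(\<lambda>v. c + K *\<^sub>v v) \<in> N \<rightarrow>\<^sub>M borel_vec k"
    unfolding measurable_cong_sets[OF N'(4) refl]
    using c by (intro measurable_add_borel_vec measurable_mult_mat_vec_borel_vec[OF K]) simp
  have "distr (distr N (borel_vec k) (\<lambda>v. c + K *\<^sub>v v)) borel (\<lambda>x. scalar_prod a x) =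
      normal_real (scalar_prod a (c + K *\<^sub>v \<mu>)) (scalar_prod a ((K * S * transpose_mat K) *\<^sub>v a))"
    if a: "a \<in> carrier_vec k" for a
  proof -
    let ?b = "transpose_mat K *\<^sub>v a"
    have b: "?b \<in> carrier_vec n" using K a by simp
    have meas: "(\<lambda>x. scalar_prod ?b x) \<in> borel_measurable N"
      unfolding measurable_cong_sets[OF N'(4) refl] by (rule measurable_scalar_prod_borel_vec) fact
    have eq: "scalar_prod a (c + K *\<^sub>v v) = scalar_prod a c + scalar_prod ?b v" if "v \<in> carrier_vec n" for v
      using that a c K by (simp add: scalar_prod_add_distrib[of _ k] transpose_vec_mult_scalar)
    have "distr (distr N (borel_vec k) (\<lambda>v. c + K *\<^sub>v v)) borel (\<lambda>x. scalar_prod a x) =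
        distr N borel (\<lambda>v. scalar_prod a (c + K *\<^sub>v v))"
      using f measurable_scalar_prod_borel_vec[OF a] by (simp add: distr_distr comp_def)
    also have "\<dots> = distr N borel (\<lambda>v. scalar_prod a c + scalar_prod ?b v)"
      by (intro distr_cong) (simp_all add: eq N'(5))
    also have "\<dots> = distr (distr N borel (\<lambda>v. scalar_prod ?b v)) borel (\<lambda>x. scalar_prod a c + x)"
      using meas by (subst distr_distr) (simp_all add: comp_def)
    also have "distr N borel (\<lambda>v. scalar_prod ?b v) = normal_real (scalar_prod ?b \<mu>) (scalar_prod ?b (S *\<^sub>v ?b))"
      using N b by (simp add: is_gaussian_def)
    finally show ?thesis
      by (simp add: distr_normal_real_add eq[OF N'(1)] quadratic_form_congruence[OF K N'(2) a])
  qed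
  then show ?thesis
    using N' K c sym_psd_congruence[OF K N'(3)] by (simp add: is_gaussian_def)
qed

text \<open>By Fubini the characteristic function of the sum factors, so the exponents of the two
  parts add; the two equations assumed say exactly that means and covariances add up to those of
  \<open>N\<close>. This takes the place of an independence statement for the two parts of a single
  vector.\<close>

lemma is_gaussian_split:
  assumes N: "is_gaussian n \<mu> S N" and D: "D \<in> carrier_mat n n" and R: "R \<in> carrier_mat n n"
    and \<mu>: "D *\<^sub>v \<mu> + R *\<^sub>v \<mu> = \<mu>"
    and S: "D * S * transpose_mat D + R * S * transpose_mat R = S"
  shows "distr (N \<Otimes>\<^sub>M N) (borel_vec n) (\<lambda>(v, w). D *\<^sub>v v + R *\<^sub>v w) = N"
proof (rule borel_vec_eqI_char)
  note N' = is_gaussianD[OF N]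
  interpret prob_space N by (rule N')
  interpret NN: pair_prob_space N N ..
  have f: "(\<lambda>(v, w). D *\<^sub>v v + R *\<^sub>v w) \<in> N \<Otimes>\<^sub>M N \<rightarrow>\<^sub>M borel_vec n"
    unfolding case_prod_beta
    by (intro measurable_add_borel_vec measurable_compose[OF measurable_fst] measurable_compose[OF measurable_snd])
      (simp_all add: measurable_cong_sets[OF N'(4) refl] measurable_mult_mat_vec_borel_vec D R)
  show "prob_space (distr (N \<Otimes>\<^sub>M N) (borel_vec n) (\<lambda>(v, w). D *\<^sub>v v + R *\<^sub>v w))"
    using f by (rule NN.prob_space_distr)
  show "prob_space N" "sets N = sets (borel_vec n)" by (rule N')+
  fix a :: "real vec" assume a: "a \<in> carrier_vec n"
  let ?d = "transpose_mat D *\<^sub>v a" and ?r = "transpose_mat R *\<^sub>v a"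
  have dr: "?d \<in> carrier_vec n" "?r \<in> carrier_vec n" using D R a by auto
  have eq: "scalar_prod a (D *\<^sub>v v + R *\<^sub>v w) = scalar_prod ?d v + scalar_prod ?r w"
    if "v \<in> carrier_vec n" "w \<in> carrier_vec n" for v w
    using that a D R by (simp add: scalar_prod_add_distrib[of _ n] transpose_vec_mult_scalar)
  have [measurable]: "(\<lambda>x. scalar_prod ?d x) \<in> borel_measurable N" "(\<lambda>x. scalar_prod ?r x) \<in> borel_measurable N"
    using dr by (simp_all add: measurable_cong_sets[OF N'(4) refl] measurable_scalar_prod_borel_vec)
  have int: "integrable (N \<Otimes>\<^sub>M N) (\<lambda>(v, w). iexp (scalar_prod ?d v) * iexp (scalar_prod ?r w))"
    by (intro NN.integrable_const_bound[of _ 1]) (auto simp: norm_mult case_prod_beta)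
  have "(CLINT v|distr (N \<Otimes>\<^sub>M N) (borel_vec n) (\<lambda>(v, w). D *\<^sub>v v + R *\<^sub>v w). iexp (scalar_prod a v)) =
      (CLINT p|N \<Otimes>\<^sub>M N. iexp (scalar_prod a (case p of (v, w) \<Rightarrow> D *\<^sub>v v + R *\<^sub>v w)))"
  proof (rule integral_distr[OF f])
    note measurable_scalar_prod_borel_vec[OF a, measurable]
    show "(\<lambda>v. iexp (scalar_prod a v)) \<in> borel_measurable (borel_vec n)" by measurable
  qed
  also have "\<dots> = (CLINT p|N \<Otimes>\<^sub>M N. (case p of (v, w) \<Rightarrow> iexp (scalar_prod ?d v) * iexp (scalar_prod ?r w)))"
    by (intro Bochner_Integration.integral_cong)
      (auto simp: space_pair_measure N'(5) eq exp_add distrib_left)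
  also have "\<dots> = (CLINT v|N. CLINT w|N. iexp (scalar_prod ?d v) * iexp (scalar_prod ?r w))"
    using NN.integral_fst[OF int] by simp
  also have "\<dots> = (CLINT v|N. iexp (scalar_prod ?d v)) * (CLINT w|N. iexp (scalar_prod ?r w))"
    by simp
  also have "\<dots> = exp (\<i> * (scalar_prod ?d \<mu> + scalar_prod ?r \<mu>) -
      (scalar_prod ?d (S *\<^sub>v ?d) + scalar_prod ?r (S *\<^sub>v ?r)) / 2)"
    unfolding is_gaussian_char[OF N dr(1)] is_gaussian_char[OF N dr(2)] exp_add[symmetric]
    by (simp add: algebra_simps add_divide_distrib)
  also have "scalar_prod ?d \<mu> + scalar_prod ?r \<mu> = scalar_prod a \<mu>"
    using eq[OF N'(1) N'(1)] \<mu> by simp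
  also have "scalar_prod ?d (S *\<^sub>v ?d) + scalar_prod ?r (S *\<^sub>v ?r) =
      scalar_prod a ((D * S * transpose_mat D + R * S * transpose_mat R) *\<^sub>v a)"
  proof -
    have "D * S * transpose_mat D \<in> carrier_mat n n" "R * S * transpose_mat R \<in> carrier_mat n n"
      using D R N'(2) by auto
    then show ?thesis
      unfolding quadratic_form_congruence[OF D N'(2) a, symmetric] quadratic_form_congruence[OF R N'(2) a, symmetric]
      using a by (subst add_mult_distrib_mat_vec[of _ n n]) (auto intro!: scalar_prod_add_distrib[symmetric])
  qed
  also have "exp (\<i> * complex_of_real (scalar_prod a \<mu>) -
      complex_of_real (scalar_prod a ((D * S * transpose_mat D + R * S * transpose_mat R) *\<^sub>v a) / 2)) =
      (CLINT v|N. iexp (scalar_prod a v))"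
    unfolding S is_gaussian_char[OF N a] by simp
  finally show "(CLINT v|distr (N \<Otimes>\<^sub>M N) (borel_vec n) (\<lambda>(v, w). D *\<^sub>v v + R *\<^sub>v w). iexp (scalar_prod a v)) =
      (CLINT v|N. iexp (scalar_prod a v))" .
qed simp

section \<open>Positive mass of boxes under nondegenerate Gaussians\<close>

lemma box_in_sets_borel_vec:
  "{v \<in> carrier_vec m. \<forall>i<m. \<bar>v $ i - y $ i\<bar> < r} \<in> sets (borel_vec m)"
proof -
  have "(\<lambda>v. v $ i) \<in> borel_measurable (borel_vec m)" if "i < m" for i
    by (rule measurable_borel_vec_index) fact
  then have "{v \<in> space (borel_vec m). \<forall>i\<in>{..<m}. \<bar>v $ i - y $ i\<bar> < r} \<in> sets (borel_vec m)"
    by (intro sets.sets_Collect_finite_All borel_measurable_less) auto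
  then show ?thesis by (simp only: space_borel_vec Ball_def lessThan_iff)
qed

text \<open>The density is positive everywhere, so mass zero would make the interval Lebesgue
  null.\<close>

lemma normal_real_interval_pos:
  assumes "0 < v" and "l < u"
  shows "0 < emeasure (normal_real \<mu> v) {l<..<u}"
proof (rule ccontr)
  assume "\<not> 0 < emeasure (normal_real \<mu> v) {l<..<u}"
  then have "(\<integral>\<^sup>+x. ennreal (normal_density \<mu> (sqrt v) x) * indicator {l<..<u} x \<partial>lborel) = 0"
    using assms by (simp add: normal_real_def emeasure_density)
  then have "AE x in lborel. ennreal (normal_density \<mu> (sqrt v) x) * indicator {l<..<u} x = 0"
    by (subst (asm) nn_integral_0_iff_AE) auto
  then have "AE x in lborel. x \<notin> {l<..<u}"
  proof (rule eventually_mono)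
    fix x assume "ennreal (normal_density \<mu> (sqrt v) x) * indicator {l<..<u} x = 0"
    moreover have "ennreal (normal_density \<mu> (sqrt v) x) > 0"
      using assms normal_density_pos[of "sqrt v" \<mu> x] by simp
    ultimately show "x \<notin> {l<..<u}" by (auto simp: indicator_def)
  qed
  then have "emeasure lborel {l<..<u} = 0"
    by (subst (asm) AE_iff_measurable[of "{l<..<u}"]) auto
  then show False using assms by simp
qed

text \<open>With identity covariance the characteristic function is a product over the coordinates,
  so \<open>N\<close> is a product of univariate normal laws and the mass of a box is a product of
  positive numbers.\<close>

lemma std_gaussian_box_pos:
  assumes N: "is_gaussian m \<mu> (1\<^sub>m m) N" and e: "0 < e"
  shows "0 < emeasure N {v \<in> carrier_vec m. \<forall>i<m. \<bar>v $ i - c $ i\<bar> < e}"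
proof -
  let ?M = "\<lambda>i. normal_real (\<mu> $ i) 1"
  let ?P = "Pi\<^sub>M {..<m} ?M"
  interpret M: prob_space "?M i" for i by (rule prob_space_normal_real)
  interpret P: product_prob_space ?M "{..<m}" ..
  note N' = is_gaussianD[OF N]
  have comp: "(\<lambda>f. f i) \<in> borel_measurable ?P" if "i < m" for i
    using measurable_component_singleton[of i "{..<m}" ?M] that by (simp cong: measurable_cong_sets)
  have f: "(\<lambda>f. vec m f) \<in> ?P \<rightarrow>\<^sub>M borel_vec m"
    using comp by (intro measurable_borel_vecI) auto
  have "distr ?P (borel_vec m) (\<lambda>f. vec m f) = N"
  proof (rule borel_vec_eqI_char)
    show "prob_space (distr ?P (borel_vec m) (\<lambda>f. vec m f))"
      using f by (rule P.prob_space_distr)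
    show "prob_space N" "sets N = sets (borel_vec m)" by (rule N')+
    fix a :: "real vec" assume a: "a \<in> carrier_vec m"
    have "(CLINT v|distr ?P (borel_vec m) (\<lambda>f. vec m f). iexp (scalar_prod a v)) =
        (CLINT f|?P. iexp (scalar_prod a (vec m f)))"
    proof (rule integral_distr[OF f])
      note measurable_scalar_prod_borel_vec[OF a, measurable]
      show "(\<lambda>v. iexp (scalar_prod a v)) \<in> borel_measurable (borel_vec m)" by measurable
    qed
    also have "(\<lambda>f. iexp (scalar_prod a (vec m f))) = (\<lambda>f. \<Prod>i<m. iexp (a $ i * f i))"
      by (simp add: scalar_prod_def lessThan_atLeast0 sum_distrib_left exp_sum)
    also have "(CLINT f|?P. \<Prod>i<m. iexp (a $ i * f i)) = (\<Prod>i<m. CLINT x|?M i. iexp (a $ i * x))"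
      by (intro P.product_integral_prod M.integrable_iexp) auto
    also have "\<dots> = (\<Prod>i<m. exp (\<i> * (a $ i * \<mu> $ i) - (a $ i)\<^sup>2 / 2))"
      using char_normal_real[of 1] by (intro prod.cong refl) (simp add: char_def)
    also have "\<dots> = exp (\<Sum>i<m. \<i> * (a $ i * \<mu> $ i) - (a $ i)\<^sup>2 / 2)"
      by (simp add: exp_sum)
    also have "(\<Sum>i<m. \<i> * (a $ i * \<mu> $ i) - complex_of_real ((a $ i)\<^sup>2 / 2)) =
        \<i> * scalar_prod a \<mu> - scalar_prod a (1\<^sub>m m *\<^sub>v a) / 2"
      using a N'(1)
      by (simp add: scalar_prod_def lessThan_atLeast0 sum_subtractf sum_distrib_left sum_divide_distrib power2_eq_square)
    finally show "(CLINT v|distr ?P (borel_vec m) (\<lambda>f. vec m f). iexp (scalar_prod a v)) =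
        (CLINT v|N. iexp (scalar_prod a v))"
      using is_gaussian_char[OF N a] by simp
  qed simp
  then have "emeasure N {v \<in> carrier_vec m. \<forall>i<m. \<bar>v $ i - c $ i\<bar> < e} =
      emeasure (distr ?P (borel_vec m) (\<lambda>f. vec m f)) {v \<in> carrier_vec m. \<forall>i<m. \<bar>v $ i - c $ i\<bar> < e}"
    by simp
  also have "\<dots> = emeasure ?P ((\<lambda>f. vec m f) -` {v \<in> carrier_vec m. \<forall>i<m. \<bar>v $ i - c $ i\<bar> < e} \<inter> space ?P)"
    by (rule emeasure_distr[OF f box_in_sets_borel_vec])
  also have "(\<lambda>f. vec m f) -` {v \<in> carrier_vec m. \<forall>i<m. \<bar>v $ i - c $ i\<bar> < e} \<inter> space ?P =
      Pi\<^sub>E {..<m} (\<lambda>i. {c $ i - e<..<c $ i + e})"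
  proof -
    have "\<bar>r - y\<bar> < e \<longleftrightarrow> r \<in> {y - e<..<y + e}" for r y :: real by auto
    then show ?thesis by (simp add: space_PiM PiE_def Pi_def set_eq_iff)
  qed
  also have "emeasure ?P \<dots> = (\<Prod>i<m. emeasure (?M i) {c $ i - e<..<c $ i + e})"
    by (intro P.emeasure_PiM) auto
  also have "\<dots> > 0"
    using e normal_real_interval_pos[of 1] by (auto simp: zero_less_iff_neq_zero prod_zero_iff)
  finally show ?thesis .
qed

text \<open>Whitening by the inverse \<open>H\<close> of \<open>L\<close> turns the covariance into
  the identity. A small box around \<open>H z\<close> then has positive mass, and \<open>L\<close>
  maps it into the given box around \<open>z\<close>.\<close>

lemma gaussian_box_pos:
  assumes N: "is_gaussian m \<mu> (L * transpose_mat L) N" and L: "L \<in> carrier_mat m m" "det L \<noteq> 0"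
    and z: "z \<in> carrier_vec m" and e: "0 < e"
  shows "0 < emeasure N {v \<in> carrier_vec m. \<forall>i<m. \<bar>v $ i - z $ i\<bar> < e}"
proof -
  define H where "H = mat_inv L"
  note H = mat_inv_left_right[OF L, folded H_def]
  note N' = is_gaussianD[OF N]
  have HS: "H * (L * transpose_mat L) * transpose_mat H = 1\<^sub>m m"
  proof -
    have LT: "transpose_mat L \<in> carrier_mat m m" using L by simp
    have "H * (L * transpose_mat L) = transpose_mat L"
      unfolding assoc_mult_mat[OF H(1) L(1) LT, symmetric] H(2) using LT by (rule left_mult_one_mat)
    then show ?thesis
      using transpose_mult[OF H(1) L(1)] by (simp only: H transpose_one)
  qed
  have T: "is_gaussian m (0\<^sub>v m + H *\<^sub>v \<mu>) (1\<^sub>m m) (distr N (borel_vec m) (\<lambda>v. 0\<^sub>v m + H *\<^sub>v v))"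
    using is_gaussian_affine[OF N H(1) zero_carrier_vec] unfolding HS .
  define c where "c = H *\<^sub>v z"
  have c: "c \<in> carrier_vec m" "L *\<^sub>v c = z"
    using H L z by (auto simp: c_def simp flip: assoc_mult_mat_vec[of L m m H m])
  \<comment> \<open>\<open>s\<close> dominates every absolute row sum of \<open>L\<close>, so
    \<open>L\<close> enlarges coordinatewise distances at most by the factor \<open>s\<close>. The 1
    in the radius \<open>d\<close> gives the strict bound \<open>s * d < e\<close> and keeps the
    denominator positive even if \<open>s\<close> is zero.\<close>
  define s where "s = (\<Sum>i<m. \<Sum>j<m. \<bar>L $$ (i, j)\<bar>)"
  have s0: "0 \<le> s" by (auto simp: s_def intro!: sum_nonneg)
  define d where "d = e / (1 + s)"
  have d: "0 < d" using s0 e by (simp add: d_def)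
  have sd: "s * d < e" using s0 e by (simp add: d_def field_simps)
  let ?E = "{v \<in> carrier_vec m. \<forall>i<m. \<bar>v $ i - c $ i\<bar> < d}"
  let ?F = "{v \<in> carrier_vec m. \<forall>i<m. \<bar>v $ i - z $ i\<bar> < e}"
  have f: "(\<lambda>v. 0\<^sub>v m + H *\<^sub>v v) \<in> N \<rightarrow>\<^sub>M borel_vec m"
    unfolding measurable_cong_sets[OF N'(4) refl]
    by (intro measurable_add_borel_vec measurable_mult_mat_vec_borel_vec[OF H(1)]) simp
  have pos: "0 < emeasure N ((\<lambda>v. 0\<^sub>v m + H *\<^sub>v v) -` ?E \<inter> space N)"
    using std_gaussian_box_pos[OF T d, of c] unfolding emeasure_distr[OF f box_in_sets_borel_vec] .
  have sub: "(\<lambda>v. 0\<^sub>v m + H *\<^sub>v v) -` ?E \<inter> space N \<subseteq> ?F"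
  proof (intro subsetI CollectI conjI allI impI)
      fix v assume "v \<in> (\<lambda>v. 0\<^sub>v m + H *\<^sub>v v) -` ?E \<inter> space N"
      then have v: "v \<in> carrier_vec m" and close: "\<forall>j<m. \<bar>(0\<^sub>v m + H *\<^sub>v v) $ j - c $ j\<bar> < d"
        by (auto simp: N'(5))
      then show "v \<in> carrier_vec m" by simp
      fix i assume i: "i < m"
      define t where "t = H *\<^sub>v v"
      have t: "t \<in> carrier_vec m" "L *\<^sub>v t = v"
        using H L v by (auto simp: t_def simp flip: assoc_mult_mat_vec[of L m m H m])
      have close': "\<bar>t $ j - c $ j\<bar> \<le> d" if "j < m" for j
        using close that H v by (force simp: t_def)
      have L_sum: "(L *\<^sub>v y) $ i = (\<Sum>j<m. L $$ (i, j) * y $ j)" if "y \<in> carrier_vec m" for y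
        using L(1) that i by (simp add: scalar_prod_def lessThan_atLeast0)
      have "v $ i - z $ i = (\<Sum>j<m. L $$ (i, j) * (t $ j - c $ j))"
        using L_sum[OF t(1)] L_sum[OF c(1)] unfolding t(2) c(2) right_diff_distrib sum_subtractf by simp
      then have "\<bar>v $ i - z $ i\<bar> \<le> (\<Sum>j<m. \<bar>L $$ (i, j) * (t $ j - c $ j)\<bar>)"
        by (simp only: sum_abs)
      also have "\<dots> \<le> (\<Sum>j<m. \<bar>L $$ (i, j)\<bar> * d)"
        using close' by (intro sum_mono) (auto simp: abs_mult intro!: mult_left_mono)
      also have "\<dots> \<le> s * d"
        unfolding s_def sum_distrib_right[symmetric] using i d
        by (intro mult_right_mono member_le_sum[of i "{..<m}" "\<lambda>i. \<Sum>j<m. \<bar>L $$ (i, j)\<bar>"]) (auto intro!: sum_nonneg)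
      also have "\<dots> < e" by (rule sd)
      finally show "\<bar>v $ i - z $ i\<bar> < e" .
    qed
  have "?F \<in> sets N" unfolding N'(4) by (rule box_in_sets_borel_vec)
  from less_le_trans[OF pos emeasure_mono[OF sub this]] show ?thesis .
qed

subsection \<open>Conditioning\<close>

text \<open>Abstract form of the conditioning step: \<open>Q * B\<close> and \<open>R\<close> split
  the identity, and the assumption on \<open>S\<close> says that the split leaves no cross
  covariance. The factor \<open>L\<close> certifies that the law of \<open>B x\<close> is
  nondegenerate.\<close>

lemma gaussian_cond_distr_at:
  assumes x: "x \<in> M \<rightarrow>\<^sub>M borel_vec n"
    and N: "is_gaussian n \<mu> S (distr M (borel_vec n) x)"
    and B: "B \<in> carrier_mat m n" and Q: "Q \<in> carrier_mat n m" and R: "R \<in> carrier_mat n n"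
    and QBR: "\<And>v. v \<in> carrier_vec n \<Longrightarrow> (Q * B) *\<^sub>v v + R *\<^sub>v v = v"
    and BQ: "B * Q = 1\<^sub>m m"
    and S: "(Q * B) * S * transpose_mat (Q * B) + R * S * transpose_mat R = S"
    and L: "L \<in> carrier_mat m m" "det L \<noteq> 0" "B * S * transpose_mat B = L * transpose_mat L"
    and z: "z \<in> carrier_vec m"
  shows "cond_distr_at M n x m (\<lambda>\<omega>. B *\<^sub>v x \<omega>) z
    (distr (distr M (borel_vec n) x) (borel_vec n) (\<lambda>w. Q *\<^sub>v z + R *\<^sub>v w))"
proof -
  define N where "N = distr M (borel_vec n) x"
  note N = N[folded N_def]
  note N' = is_gaussianD[OF N]
  interpret prob_space N by (rule N')
  define \<kappa> where "\<kappa> y = distr N (borel_vec n) (\<lambda>w. Q *\<^sub>v y + R *\<^sub>v w)" for y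
  note cong_N = measurable_cong_sets[OF N'(4) refl]
  have QB: "Q * B \<in> carrier_mat n n" using Q B by simp
  have BR: "B *\<^sub>v ((Q * B) *\<^sub>v v + R *\<^sub>v w) = B *\<^sub>v v"
    if v: "v \<in> carrier_vec n" and w: "w \<in> carrier_vec n" for v w
  proof -
    have BQB: "B *\<^sub>v ((Q * B) *\<^sub>v u) = B *\<^sub>v u" if "u \<in> carrier_vec n" for u
    proof -
      have "B *\<^sub>v ((Q * B) *\<^sub>v u) = (B * Q) *\<^sub>v (B *\<^sub>v u)"
        using that B Q by (simp add: assoc_mult_mat_vec[of _ n m _ n] assoc_mult_mat_vec[of _ m n _ m])
      then show ?thesis using that B by (simp add: BQ)
    qed
    \<comment> \<open>Apply \<open>B\<close> to the splitting of \<open>w\<close>: the first part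
      already gives all of \<open>B w\<close>, so \<open>B\<close> annihilates the range of
      \<open>R\<close>.\<close>
    have "B *\<^sub>v w = B *\<^sub>v ((Q * B) *\<^sub>v w) + B *\<^sub>v (R *\<^sub>v w)"
      using arg_cong[OF QBR[OF w], of "\<lambda>v. B *\<^sub>v v"] w R QB
      by (subst (asm) mult_add_distrib_mat_vec[OF B]) auto
    then have "B *\<^sub>v (R *\<^sub>v w) = 0\<^sub>v m"
      unfolding BQB[OF w] using w B R by (auto simp: vec_eq_iff)
    then show ?thesis
      using v w B R QB by (subst mult_add_distrib_mat_vec[OF B]) (auto simp: BQB)
  qed
  have add_meas: "(\<lambda>w. c + R *\<^sub>v w) \<in> N \<rightarrow>\<^sub>M borel_vec n" if "c \<in> carrier_vec n" for c
    unfolding cong_N using that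
    by (intro measurable_add_borel_vec measurable_mult_mat_vec_borel_vec[OF R]) simp
  have B_meas: "(\<lambda>v. B *\<^sub>v v) \<in> N \<rightarrow>\<^sub>M borel_vec m"
    unfolding cong_N by (rule measurable_mult_mat_vec_borel_vec[OF B])
  have Bx_meas: "(\<lambda>\<omega>. B *\<^sub>v x \<omega>) \<in> M \<rightarrow>\<^sub>M borel_vec m"
    using measurable_compose[OF x measurable_mult_mat_vec_borel_vec[OF B]] .
  have law_Bx: "distr M (borel_vec m) (\<lambda>\<omega>. B *\<^sub>v x \<omega>) = distr N (borel_vec m) (\<lambda>v. B *\<^sub>v v)"
    unfolding N_def using measurable_mult_mat_vec_borel_vec[OF B] x by (simp add: distr_distr comp_def)
  have \<kappa>_meas: "\<kappa> \<in> borel_vec m \<rightarrow>\<^sub>M prob_algebra (borel_vec n)"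
    unfolding \<kappa>_def
  proof (rule measurable_distr_prob_space2)
    show "(\<lambda>_. N) \<in> borel_vec m \<rightarrow>\<^sub>M prob_algebra (borel_vec n)"
      using N' by (intro measurable_const) (simp add: space_prob_algebra)
    show "(\<lambda>(y, w). Q *\<^sub>v y + R *\<^sub>v w) \<in> borel_vec m \<Otimes>\<^sub>M borel_vec n \<rightarrow>\<^sub>M borel_vec n"
      unfolding case_prod_beta
      by (intro measurable_add_borel_vec measurable_compose[OF measurable_fst] measurable_compose[OF measurable_snd]
          measurable_mult_mat_vec_borel_vec Q R)
  qed
  have joint: "emeasure M {\<omega> \<in> space M. x \<omega> \<in> E \<and> B *\<^sub>v x \<omega> \<in> C} =
      (\<integral>\<^sup>+ y. emeasure (\<kappa> y) E * indicator C y \<partial>(distr M (borel_vec m) (\<lambda>\<omega>. B *\<^sub>v x \<omega>)))"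
    if E: "E \<in> sets (borel_vec n)" and C: "C \<in> sets (borel_vec m)" for E C
  proof -
    \<comment> \<open>As \<open>B x\<close> is a function of x, the joint event is an event about x
      alone, and x may be replaced by the sum built from two copies.\<close>
    define T where "T = E \<inter> ((\<lambda>v. B *\<^sub>v v) -` C \<inter> carrier_vec n)"
    have T: "T \<in> sets (borel_vec n)"
      unfolding T_def using E measurable_sets[OF measurable_mult_mat_vec_borel_vec[OF B] C] by auto
    let ?f = "\<lambda>(v, w). (Q * B) *\<^sub>v v + R *\<^sub>v w"
    have f: "?f \<in> N \<Otimes>\<^sub>M N \<rightarrow>\<^sub>M borel_vec n"
      unfolding case_prod_beta
      by (intro measurable_add_borel_vec measurable_compose[OF measurable_fst] measurable_compose[OF measurable_snd])
        (simp_all add: cong_N measurable_mult_mat_vec_borel_vec QB R)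
    have split: "distr (N \<Otimes>\<^sub>M N) (borel_vec n) ?f = N"
      by (rule is_gaussian_split[OF N QB R QBR[OF N'(1)] S])
    have "x -` T \<inter> space M = {\<omega> \<in> space M. x \<omega> \<in> E \<and> B *\<^sub>v x \<omega> \<in> C}"
      using measurable_space[OF x] by (auto simp: T_def)
    then have "emeasure M {\<omega> \<in> space M. x \<omega> \<in> E \<and> B *\<^sub>v x \<omega> \<in> C} = emeasure N T"
      unfolding N_def using emeasure_distr[OF x T] by simp
    also have "\<dots> = emeasure (N \<Otimes>\<^sub>M N) (?f -` T \<inter> space (N \<Otimes>\<^sub>M N))"
      by (subst split[symmetric]) (rule emeasure_distr[OF f T])
    also have "\<dots> = (\<integral>\<^sup>+ v. emeasure N (Pair v -` (?f -` T \<inter> space (N \<Otimes>\<^sub>M N))) \<partial>N)"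
      using measurable_sets[OF f T] by (rule emeasure_pair_measure_alt)
    also have "\<dots> = (\<integral>\<^sup>+ v. emeasure (\<kappa> (B *\<^sub>v v)) E * indicator C (B *\<^sub>v v) \<partial>N)"
    proof (rule nn_integral_cong)
      fix v assume "v \<in> space N"
      then have v: "v \<in> carrier_vec n" by (simp add: N'(5))
      have QBv: "(Q * B) *\<^sub>v v = Q *\<^sub>v (B *\<^sub>v v)" "Q *\<^sub>v (B *\<^sub>v v) \<in> carrier_vec n"
        using v B Q by auto
      \<comment> \<open>By \<open>BR\<close> the condition involving \<open>C\<close> depends only
        on the first copy, so the section at \<open>v\<close> is either empty or the event whose
        mass defines the kernel at \<open>B v\<close>.\<close>
      have "Pair v -` (?f -` T \<inter> space (N \<Otimes>\<^sub>M N)) =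
          (if B *\<^sub>v v \<in> C then (\<lambda>w. Q *\<^sub>v (B *\<^sub>v v) + R *\<^sub>v w) -` E \<inter> space N else {})"
        using v R BR[OF v] QBv by (auto simp: T_def space_pair_measure N'(5))
      then show "emeasure N (Pair v -` (?f -` T \<inter> space (N \<Otimes>\<^sub>M N))) =
          emeasure (\<kappa> (B *\<^sub>v v)) E * indicator C (B *\<^sub>v v)"
        unfolding \<kappa>_def by (simp add: emeasure_distr[OF add_meas[OF QBv(2)] E])
    qed
    also have "\<dots> = (\<integral>\<^sup>+ y. emeasure (\<kappa> y) E * indicator C y \<partial>(distr N (borel_vec m) (\<lambda>v. B *\<^sub>v v)))"
    proof -
      have "(\<lambda>y. emeasure (\<kappa> y) E) \<in> borel_measurable (borel_vec m)"
        using measurable_compose[OF measurable_prob_algebraD[OF \<kappa>_meas] measurable_emeasure_subprob_algebra[OF E]] .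
      then have "(\<lambda>y. emeasure (\<kappa> y) E * indicator C y) \<in> borel_measurable (borel_vec m)"
        using C by (intro borel_measurable_times_ennreal borel_measurable_indicator)
      then show ?thesis by (subst nn_integral_distr[OF B_meas]) auto
    qed
    finally show ?thesis unfolding law_Bx .
  qed
  have regular: "regular_cond_distr M n x m (\<lambda>\<omega>. B *\<^sub>v x \<omega>) \<kappa>"
    unfolding regular_cond_distr_def using x Bx_meas \<kappa>_meas joint by blast

  have support: "0 < emeasure M {\<omega> \<in> space M. \<forall>i<m. \<bar>(B *\<^sub>v x \<omega>) $ i - z $ i\<bar> < e}" if e: "0 < e" for e
  proof -
    let ?F = "{v \<in> carrier_vec m. \<forall>i<m. \<bar>v $ i - z $ i\<bar> < e}"
    have "distr N (borel_vec m) (\<lambda>v. 0\<^sub>v m + B *\<^sub>v v) = distr M (borel_vec m) (\<lambda>\<omega>. B *\<^sub>v x \<omega>)"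
      unfolding law_Bx using B by (intro distr_cong) (auto simp: N'(5))
    then have "is_gaussian m (0\<^sub>v m + B *\<^sub>v \<mu>) (L * transpose_mat L) (distr M (borel_vec m) (\<lambda>\<omega>. B *\<^sub>v x \<omega>))"
      using is_gaussian_affine[OF N B zero_carrier_vec] L(3) by simp
    then have "0 < emeasure (distr M (borel_vec m) (\<lambda>\<omega>. B *\<^sub>v x \<omega>)) ?F"
      by (rule gaussian_box_pos[OF _ L(1,2) z e])
    also have "\<dots> = emeasure M ((\<lambda>\<omega>. B *\<^sub>v x \<omega>) -` ?F \<inter> space M)"
      by (rule emeasure_distr[OF Bx_meas box_in_sets_borel_vec])
    also have "(\<lambda>\<omega>. B *\<^sub>v x \<omega>) -` ?F \<inter> space M = {\<omega> \<in> space M. \<forall>i<m. \<bar>(B *\<^sub>v x \<omega>) $ i - z $ i\<bar> < e}"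
      using measurable_space[OF Bx_meas] by auto
    finally show ?thesis .
  qed

  have continuous: "weakly_tendsto n (\<lambda>k. \<kappa> (u k)) (\<kappa> z)"
    if u: "\<And>k. u k \<in> carrier_vec m" and lim: "vec_tendsto m u z" for u
    unfolding weakly_tendsto_def
  proof (intro allI impI)
    fix f :: "real vec \<Rightarrow> real"
    assume f: "continuous_vec n f" and "\<exists>b. \<forall>v\<in>carrier_vec n. \<bar>f v\<bar> \<le> b"
    then obtain b where b: "\<And>v. v \<in> carrier_vec n \<Longrightarrow> \<bar>f v\<bar> \<le> b" by blast
    have Qc: "Q *\<^sub>v y \<in> carrier_vec n" if "y \<in> carrier_vec m" for y using Q that by simp
    have f_meas: "(\<lambda>w. f (Q *\<^sub>v y + R *\<^sub>v w)) \<in> borel_measurable N" if "y \<in> carrier_vec m" for y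
      by (rule measurable_compose[OF add_meas[OF Qc[OF that]] continuous_vec_measurable[OF f]])
    have int: "(\<integral>v. f v \<partial>\<kappa> y) = (\<integral>w. f (Q *\<^sub>v y + R *\<^sub>v w) \<partial>N)" if "y \<in> carrier_vec m" for y
      unfolding \<kappa>_def by (rule integral_distr[OF add_meas[OF Qc[OF that]] continuous_vec_measurable[OF f]])
    \<comment> \<open>All kernels are images of the same \<open>N\<close>, so weak continuity is
      convergence of integrals over one fixed measure, dominated by the bound of
      \<open>f\<close>.\<close>
    have "(\<lambda>k. \<integral>w. f (Q *\<^sub>v u k + R *\<^sub>v w) \<partial>N) \<longlonglongrightarrow> (\<integral>w. f (Q *\<^sub>v z + R *\<^sub>v w) \<partial>N)"
    proof (rule integral_dominated_convergence[where w = "\<lambda>_. b"])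
      show "AE w in N. (\<lambda>k. f (Q *\<^sub>v u k + R *\<^sub>v w)) \<longlonglongrightarrow> f (Q *\<^sub>v z + R *\<^sub>v w)"
      proof (rule AE_I2)
        fix w assume "w \<in> space N"
        then have w: "w \<in> carrier_vec n" by (simp add: N'(5))
        have "(\<lambda>k. (Q *\<^sub>v u k + R *\<^sub>v w) $ i) \<longlonglongrightarrow> (Q *\<^sub>v z + R *\<^sub>v w) $ i" if i: "i < n" for i
        proof -
          have *: "(Q *\<^sub>v y + R *\<^sub>v w) $ i = (\<Sum>j<m. Q $$ (i, j) * y $ j) + (R *\<^sub>v w) $ i"
            if "y \<in> carrier_vec m" for y
            using that i Q R by (simp add: scalar_prod_def lessThan_atLeast0)
          show ?thesis
            unfolding *[OF u] *[OF z] using lim by (auto intro!: tendsto_intros simp: vec_tendsto_def)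
        qed
        then have "vec_tendsto n (\<lambda>k. Q *\<^sub>v u k + R *\<^sub>v w) (Q *\<^sub>v z + R *\<^sub>v w)"
          by (simp add: vec_tendsto_def)
        then show "(\<lambda>k. f (Q *\<^sub>v u k + R *\<^sub>v w)) \<longlonglongrightarrow> f (Q *\<^sub>v z + R *\<^sub>v w)"
          using f u z w R Qc by (simp add: continuous_vec_def)
      qed
      show "AE w in N. norm (f (Q *\<^sub>v u k + R *\<^sub>v w)) \<le> b" for k
        using b Qc[OF u] R by (intro AE_I2) (simp add: N'(5))
    qed (use f_meas u z in auto)
    then show "(\<lambda>k. \<integral>v. f v \<partial>\<kappa> (u k)) \<longlonglongrightarrow> (\<integral>v. f v \<partial>\<kappa> z)"
      by (simp add: int u z)
  qed
  show ?thesis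
    unfolding cond_distr_at_def N_def[symmetric] using z support regular continuous
    by (auto simp: \<kappa>_def[symmetric] intro!: exI[of _ \<kappa>])
qed

theorem theorem5:
  fixes n m :: nat
    and A W V Y P\<^sub>2 :: "real mat"
    and b x\<^sub>0 :: "real vec"
  assumes "1 \<le> m" and "m \<le> n"
    and "A \<in> carrier_mat n n" and "invertible_mat A"
    and "W \<in> carrier_mat n m" and "vec_space.rank n W = m"
    and "V \<in> carrier_mat n m" and "vec_space.rank n V = m"
    and "invertible_mat (transpose_mat W * A * V)"
    and "b \<in> carrier_vec n" and "x\<^sub>0 \<in> carrier_vec n"
    and "Y \<in> carrier_mat n (n - m)" and "lin_indpt_cols Y"
    and "set (cols Y) \<subseteq> mat_kernel (transpose_mat W * A)"
    and "P\<^sub>2 = Y * mat_inv (transpose_mat Y * Y) * transpose_mat Y"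
  shows "orthogonal_projector_on n P\<^sub>2 (mat_kernel (transpose_mat W * A)) \<and>
    (\<forall>G (M :: 'w measure) x.
       sym_psd n G \<longrightarrow> prob_space M \<longrightarrow> x \<in> measurable M (borel_vec n) \<longrightarrow>
       is_gaussian n x\<^sub>0 (V * transpose_mat V + P\<^sub>2 * G * transpose_mat P\<^sub>2) (distr M (borel_vec n) x) \<longrightarrow>
       (\<exists>N. is_gaussian n
              (x\<^sub>0 + V *\<^sub>v (mat_inv (transpose_mat W * A * V) *\<^sub>v (transpose_mat W *\<^sub>v (b - A *\<^sub>v x\<^sub>0))))
              (P\<^sub>2 * G * transpose_mat P\<^sub>2) N \<and>
            cond_distr_at M n x m (\<lambda>\<omega>. (transpose_mat W * A) *\<^sub>v x \<omega>) (transpose_mat W *\<^sub>v b) N))"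
proof -
  have WT: "transpose_mat W \<in> carrier_mat m n" using assms by simp
  note A = \<open>A \<in> carrier_mat n n\<close> and V = \<open>V \<in> carrier_mat n m\<close> and Y = \<open>Y \<in> carrier_mat n (n - m)\<close>
    and b = \<open>b \<in> carrier_vec n\<close> and x0 = \<open>x\<^sub>0 \<in> carrier_vec n\<close>
  define B where "B = transpose_mat W * A"
  define L where "L = B * V"
  define J where "J = mat_inv L"
  define Q where "Q = V * J"
  \<comment> \<open>\<open>D\<close> is the oblique projector onto the range of \<open>V\<close>
    along the kernel of \<open>B\<close>, and \<open>R\<close> is the complementary
    projector.\<close>
  define D where "D = Q * B"
  define R where "R = 1\<^sub>m n - D"
  have B: "B \<in> carrier_mat m n" using WT A by (simp add: B_def)
  have L: "L \<in> carrier_mat m m" using B V by (simp add: L_def)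
  have det_L: "det L \<noteq> 0"
    using det_nonzeroI_invertible_mat[OF L] assms by (simp add: L_def B_def)
  note J = mat_inv_left_right[OF L det_L, folded J_def]
  have Q: "Q \<in> carrier_mat n m" using V J by (simp add: Q_def)
  have D: "D \<in> carrier_mat n n" using Q B by (simp add: D_def)
  have R: "R \<in> carrier_mat n n" unfolding R_def using D by (rule minus_carrier_mat)
  have BQ: "B * Q = 1\<^sub>m m"
    using assoc_mult_mat[OF B V J(1)] J by (simp add: Q_def L_def)
  have BY: "B * Y = 0\<^sub>m m (n - m)"
  proof (rule eq_matI)
    fix i j assume ij: "i < dim_row (0\<^sub>m m (n - m))" "j < dim_col (0\<^sub>m m (n - m))"
    then have "col Y j \<in> set (cols Y)" using Y by (auto simp: cols_def)
    then have "B *\<^sub>v col Y j = 0\<^sub>v m"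
      using assms(14) mat_kernelD[OF B] by (auto simp: B_def)
    then have "(B *\<^sub>v col Y j) $ i = 0" using ij by simp
    then show "(B * Y) $$ (i, j) = 0\<^sub>m m (n - m) $$ (i, j)" using ij B Y by simp
  qed (use B Y in auto)
  have det_Y: "det (transpose_mat Y * Y) \<noteq> 0"
    using det_gram_nonzero[OF Y] lin_indpt_cols_ker[OF Y \<open>lin_indpt_cols Y\<close>] by blast
  have proj: "orthogonal_projector_on n P\<^sub>2 (mat_kernel B)"
    unfolding assms(15) by (rule orthogonal_projector_on_mat_kernel[OF \<open>m \<le> n\<close> B Q BQ Y BY det_Y])
  then have P: "P\<^sub>2 \<in> carrier_mat n n" by (simp add: orthogonal_projector_on_def)
  have BP: "B * P\<^sub>2 = 0\<^sub>m m n"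
  proof (rule eq_matI)
    fix i j assume ij: "i < dim_row (0\<^sub>m m n)" "j < dim_col (0\<^sub>m m n)"
    \<comment> \<open>Columns are images of unit vectors, hence lie in the range, which is the
      kernel of \<open>B\<close> by \<open>proj\<close>.\<close>
    have "col P\<^sub>2 j = P\<^sub>2 *\<^sub>v unit_vec n j" using P ij by (auto simp: scalar_prod_right_unit)
    then have "col P\<^sub>2 j \<in> mat_kernel B"
      using proj by (auto simp: orthogonal_projector_on_def)
    then have "(B *\<^sub>v col P\<^sub>2 j) $ i = 0" using mat_kernelD[OF B] ij by simp
    then show "(B * P\<^sub>2) $$ (i, j) = 0\<^sub>m m n $$ (i, j)" using ij B P by simp
  qed (use B P in auto)
  have DV: "D * V = V"
  proof -
    have "D * V = V * (J * L)"
      using V J B Q L by (simp add: D_def Q_def L_def assoc_mult_mat[of _ n m _ n] assoc_mult_mat[of _ n m _ m])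
    then show ?thesis using J V by simp
  qed
  have DP: "D * P\<^sub>2 = 0\<^sub>m n n"
    using assoc_mult_mat[OF Q B P] Q by (simp add: D_def BP)
  have RV: "R * V = 0\<^sub>m n m"
    using minus_mult_distrib_mat[OF one_carrier_mat D V] V DV by (auto simp: R_def)
  have RP: "R * P\<^sub>2 = P\<^sub>2"
    using minus_mult_distrib_mat[OF one_carrier_mat D P] P DP by (auto simp: R_def)
  have QBR: "(Q * B) *\<^sub>v v + R *\<^sub>v v = v" if "v \<in> carrier_vec n" for v
    using that D by (auto simp: R_def minus_mult_distrib_mat_vec[of _ n n] simp flip: D_def)

  show ?thesis
    unfolding B_def[symmetric] L_def[symmetric]
  proof (intro conjI allI impI)
    show "orthogonal_projector_on n P\<^sub>2 (mat_kernel B)" by (rule proj)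
    fix G and M :: "'w measure" and x
    define C where "C = P\<^sub>2 * G * transpose_mat P\<^sub>2"
    assume G: "sym_psd n G" and "prob_space M" and x: "x \<in> measurable M (borel_vec n)"
      and "is_gaussian n x\<^sub>0 (V * transpose_mat V + P\<^sub>2 * G * transpose_mat P\<^sub>2) (distr M (borel_vec n) x)"
    then have N: "is_gaussian n x\<^sub>0 (V * transpose_mat V + C) (distr M (borel_vec n) x)" by (simp add: C_def)
    have G': "G \<in> carrier_mat n n" using G by (simp add: sym_psd_def)
    have C: "C \<in> carrier_mat n n" using P G' by (simp add: C_def)
    have VV: "V * transpose_mat V \<in> carrier_mat n n" using V by simp
    \<comment> \<open>Both summands of the covariance are themselves congruences, so the products of
      \<open>K\<close> with \<open>V\<close> and \<open>P\<^sub>2\<close> determine the result. The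
      cases \<open>D\<close>, \<open>R\<close> and \<open>B\<close> each leave a single
      summand.\<close>
    have cong: "K * (V * transpose_mat V + C) * transpose_mat K =
        (K * V) * transpose_mat (K * V) + (K * P\<^sub>2) * G * transpose_mat (K * P\<^sub>2)"
      if K: "K \<in> carrier_mat k n" for K k
    proof -
      have "K * (V * transpose_mat V + C) * transpose_mat K =
          K * (V * transpose_mat V) * transpose_mat K + K * C * transpose_mat K"
        using K VV C by (simp add: mult_add_distrib_mat[of _ k n] add_mult_distrib_mat[of _ k n])
      also have "K * (V * transpose_mat V) * transpose_mat K = (K * V) * transpose_mat (K * V)"
        using K V by (simp add: transpose_mult[of _ k n] assoc_mult_mat[of _ k n _ n]
            assoc_mult_mat[of V n m _ n] assoc_mult_mat[of K k n V m _ k])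
      also have "K * C * transpose_mat K = (K * P\<^sub>2) * G * transpose_mat (K * P\<^sub>2)"
        using K P G' by (simp add: C_def transpose_mult[of _ k n] assoc_mult_mat[of _ k n _ n _ n]
            assoc_mult_mat[of _ k n _ n _ k] assoc_mult_mat[of _ n n _ n _ k])
      finally show ?thesis .
    qed
    have covD: "D * (V * transpose_mat V + C) * transpose_mat D = V * transpose_mat V"
      unfolding cong[OF D] DV DP using G' VV by simp
    have covR: "R * (V * transpose_mat V + C) * transpose_mat R = C"
      unfolding cong[OF R] RV RP using C by (simp add: C_def)
    have covB: "B * (V * transpose_mat V + C) * transpose_mat B = L * transpose_mat L"
      unfolding cong[OF B] BP L_def[symmetric] using G' L by simp
    let ?z = "transpose_mat W *\<^sub>v b"
    have z: "?z \<in> carrier_vec m" using WT b by simp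
    let ?N = "distr (distr M (borel_vec n) x) (borel_vec n) (\<lambda>w. Q *\<^sub>v ?z + R *\<^sub>v w)"
    have "is_gaussian n (Q *\<^sub>v ?z + R *\<^sub>v x\<^sub>0) C ?N"
      using is_gaussian_affine[OF N R, of "Q *\<^sub>v ?z"] Q z by (simp add: covR)
    \<comment> \<open>Both sides equal \<open>x\<^sub>0\<close> plus \<open>Q\<close> applied to the
      residual \<open>?z - B x\<^sub>0\<close>, where the residual is W^T (b - A x_0).\<close>
    moreover have "Q *\<^sub>v ?z + R *\<^sub>v x\<^sub>0 = x\<^sub>0 + V *\<^sub>v (J *\<^sub>v (transpose_mat W *\<^sub>v (b - A *\<^sub>v x\<^sub>0)))"
    proof -
      have Bx: "B *\<^sub>v x\<^sub>0 \<in> carrier_vec m" using B x0 by simp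
      have "transpose_mat W *\<^sub>v (b - A *\<^sub>v x\<^sub>0) = ?z - B *\<^sub>v x\<^sub>0"
        using WT A b x0 by (simp add: B_def mult_minus_distrib_mat_vec[OF WT] assoc_mult_mat_vec[OF WT A])
      then have "V *\<^sub>v (J *\<^sub>v (transpose_mat W *\<^sub>v (b - A *\<^sub>v x\<^sub>0))) = Q *\<^sub>v (?z - B *\<^sub>v x\<^sub>0)"
        using V J z Bx by (simp add: Q_def assoc_mult_mat_vec[of _ n m _ m])
      also have "\<dots> = Q *\<^sub>v ?z - D *\<^sub>v x\<^sub>0"
        using Q z Bx x0 B by (simp add: D_def mult_minus_distrib_mat_vec[OF Q])
      finally show ?thesis
        using x0 D Q z by (auto simp: R_def minus_mult_distrib_mat_vec[of _ n n])
    qed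
    moreover have "cond_distr_at M n x m (\<lambda>\<omega>. B *\<^sub>v x \<omega>) ?z ?N"
    proof (rule gaussian_cond_distr_at[OF x N B Q R QBR BQ _ L det_L covB z])
      show "Q * B * (V * transpose_mat V + C) * transpose_mat (Q * B) + R * (V * transpose_mat V + C) * transpose_mat R =
          V * transpose_mat V + C"
        unfolding D_def[symmetric] covD covR ..
    qed
    ultimately show "\<exists>N. is_gaussian n (x\<^sub>0 + V *\<^sub>v (mat_inv L *\<^sub>v (transpose_mat W *\<^sub>v (b - A *\<^sub>v x\<^sub>0))))
          (P\<^sub>2 * G * transpose_mat P\<^sub>2) N \<and> cond_distr_at M n x m (\<lambda>\<omega>. B *\<^sub>v x \<omega>) ?z N"
      unfolding C_def[symmetric] J_def[symmetric] by auto
  qed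
qed

end
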